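(* Let $\Gamma$ be an additive subgroup of $\mathbb{R}$ which contains two $\mathbb{Q}$-linearly independent elements. Then there are a lattice $N$ and a simplicial $\Gamma$-admissible fan in $N_{\mathbb{R}}\times\mathbb{R}_{\geq0}$ which does not have a simplicial $\Gamma$-admissible completion, i.e. which is not a subfan of any complete simplicial $\Gamma$-admissible fan in $N_{\mathbb{R}}\times\mathbb{R}_{\geq0}$.
   Context: A lattice $N$ is a finitely generated free abelian group; $M=\operatorname{Hom}(N,\mathbb{Z})$, $N_{\mathbb{R}}=N\otimes_{\mathbb{Z}}\mathbb{R}$, and $\langle\cdot,\cdot\rangle$ is the natural pairing. A polyhedral complex is a finite collection of polyhedra, closed under taking faces, such that any two members intersect either in the empty set or in a common face of both. A fan is a nonempty polyhedral complex consisting of strongly convex cones (cones containing no line). A fan in $N_{\mathbb{R}}\times\mathbb{R}_{\ge0}$ is a fan in $N_{\mathbb{R}}\times\mathbb{R}$ all of whose cones lie in $N_{\mathbb{R}}\times\mathbb{R}_{\geq0}$; it is complete if the union of its cones is $N_{\mathbb{R}}\times\mathbb{R}_{\geq0}$. A fan is simplicial if each of its cones is generated by linearly independent vectors. A cone $\sigma\subset N_{\mathbb{R}}\times\mathbb{R}_{\ge0}$ is $\Gamma$-admissible if it is strongly convex and can be written as $\sigma=\{(w,t)\in N_{\mathbb{R}}\times\mathbb{R}_{\geq0}\mid \langle u_i,w\rangle+\gamma_i t\geq0\text{ for }i=1,\ldots,\ell\}$ with $u_i\in M$, $\gamma_i\in\Gamma$. A fan is $\Gamma$-admissible if all its cones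 are. *)

theory Defs
  imports "HOL-Analysis.Analysis" "HOL-Analysis.Finite_Function_Topology"
begin

text \<open>
  A lattice N is represented inside a real vector space in such a way that N tensored with the
  reals is the linear span of N: a finitely generated free abelian group is the same thing as
  the group of integer combinations of a finite set B, and the natural map from its
  scalar extension to \<open>span B\<close> is an isomorphism exactly when B is linearly independent over the
  reals.  Every lattice embeds in this way into the space of finitely supported real
  sequences \<open>nat \<Rightarrow>\<^sub>0 real\<close>.
\<close>

definition is_lattice :: "'v::real_vector set \<Rightarrow> bool" where
  "is_lattice N \<longleftrightarrow>
     (\<exists>B. finite B \<and> independent B \<and> N = range (\<lambda>c :: 'v \<Rightarrow> int. \<Sum>b\<in>B. of_int (c b) *\<^sub>R b))"

text \<open>
  The dual lattice \<open>Hom(N, \<int>)\<close>.  Its elements are given by linear functionals on the ambient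
  space that are integral on N; only their restriction to \<open>span N\<close> matters, and every
  homomorphism from N to the integers has such an extension.
\<close>

definition dual_lattice :: "'v::real_vector set \<Rightarrow> ('v \<Rightarrow> real) set" where
  "dual_lattice N = {u. linear u \<and> u ` N \<subseteq> \<int>}"

definition half_space :: "'v::real_vector set \<Rightarrow> ('v \<times> real) set" where
  "half_space N = span N \<times> {0..}"


text \<open>
  Polyhedra in a finite-dimensional subspace W of the ambient space.  (The library's
  \<open>polyhedron\<close> is only available on Euclidean spaces.)
\<close>

definition polyhedron_in :: "'a::real_vector set \<Rightarrow> 'a set \<Rightarrow> bool" where
  "polyhedron_in W P \<longleftrightarrow>
     (\<exists>H :: (('a \<Rightarrow> real) \<times> real) set. finite H \<and> (\<forall>(f, c)\<in>H. linear f) \<and>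
        P = {x \<in> W. \<forall>(f, c)\<in>H. f x \<ge> c})"

text \<open>
  The library's \<open>face_of\<close> counts the empty set as a face, which is not wanted here: a fan
  consists of cones, and these are nonempty.
\<close>

definition polyhedral_complex :: "'a::real_vector set \<Rightarrow> 'a set set \<Rightarrow> bool" where
  "polyhedral_complex W C \<longleftrightarrow>
     finite C \<and>
     (\<forall>P\<in>C. polyhedron_in W P) \<and>
     (\<forall>P\<in>C. \<forall>F. F face_of P \<and> F \<noteq> {} \<longrightarrow> F \<in> C) \<and>
     (\<forall>P\<in>C. \<forall>Q\<in>C. P \<inter> Q = {} \<or> (P \<inter> Q face_of P \<and> P \<inter> Q face_of Q))"

definition contains_line :: "'a::real_vector set \<Rightarrow> bool" where
  "contains_line S \<longleftrightarrow> (\<exists>x v. v \<noteq> 0 \<and> (\<forall>r :: real. x + r *\<^sub>R v \<in> S))"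

definition strongly_convex_cone :: "'a::real_vector set \<Rightarrow> bool" where
  "strongly_convex_cone \<sigma> \<longleftrightarrow> convex_cone \<sigma> \<and> \<not> contains_line \<sigma>"

definition fan :: "'a::real_vector set \<Rightarrow> 'a set set \<Rightarrow> bool" where
  "fan W \<Sigma> \<longleftrightarrow> polyhedral_complex W \<Sigma> \<and> \<Sigma> \<noteq> {} \<and> (\<forall>\<sigma>\<in>\<Sigma>. strongly_convex_cone \<sigma>)"

definition half_space_fan :: "'v::real_vector set \<Rightarrow> ('v \<times> real) set set \<Rightarrow> bool" where
  "half_space_fan N \<Sigma> \<longleftrightarrow> fan (span N \<times> UNIV) \<Sigma> \<and> (\<forall>\<sigma>\<in>\<Sigma>. \<sigma> \<subseteq> half_space N)"

definition complete_fan :: "'v::real_vector set \<Rightarrow> ('v \<times> real) set set \<Rightarrow> bool" where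
  "complete_fan N \<Sigma> \<longleftrightarrow> \<Union>\<Sigma> = half_space N"

definition simplicial_fan :: "'a::real_vector set set \<Rightarrow> bool" where
  "simplicial_fan \<Sigma> \<longleftrightarrow>
     (\<forall>\<sigma>\<in>\<Sigma>. \<exists>B. finite B \<and> independent B \<and> \<sigma> = convex_cone hull B)"

definition admissible_cone :: "real set \<Rightarrow> 'v::real_vector set \<Rightarrow> ('v \<times> real) set \<Rightarrow> bool" where
  "admissible_cone \<Gamma> N \<sigma> \<longleftrightarrow>
     strongly_convex_cone \<sigma> \<and>
     (\<exists>(l :: nat) u \<gamma>.
        (\<forall>i\<in>{1..l}. u i \<in> dual_lattice N \<and> \<gamma> i \<in> \<Gamma>) \<and>
        \<sigma> = {(w, t) \<in> half_space N. \<forall>i\<in>{1..l}. u i w + \<gamma> i * t \<ge> 0})"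

definition admissible_fan :: "real set \<Rightarrow> 'v::real_vector set \<Rightarrow> ('v \<times> real) set set \<Rightarrow> bool" where
  "admissible_fan \<Gamma> N \<Sigma> \<longleftrightarrow> (\<forall>\<sigma>\<in>\<Sigma>. admissible_cone \<Gamma> N \<sigma>)"

end

theory Submission
  imports Defs
begin

text \<open>
  Take N of rank two and let a and b be positive elements of \<open>\<Gamma>\<close> with b/a irrational.  At
  height 1, consider the three segments from (0,0) to (a,0), from (0,0) to (0,b), and from (c,0) to
  (0,c), where c = a + b.  Admissibility forces every segment of a complex to have rational slope.
  Suppose a simplicial admissible completion existed, and turn around the origin from the first
  segment to the second.  The cells met at the origin are bounded triangles, because the third
  segment blocks every unbounded cell.  If one edge vector of a triangle with rational slopes lies in
  \<open>a \<rat>\<^sup>2\<close>, then so do the other two; hence all the edges at the origin passed on the way have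
  their endpoints in \<open>a \<rat>\<^sup>2\<close>.  The last of them is (0,b), so b/a would be rational.
\<close>

subsection \<open>Simplicial cones and fans\<close>

lemma convex_cone_hull_finite:
  fixes B :: "'a::real_vector set"
  assumes "finite B"
  shows "convex_cone hull B = {\<Sum>b\<in>B. c b *\<^sub>R b | c. \<forall>b\<in>B. 0 \<le> c b}" (is "_ = ?R")
proof (rule hull_unique)
  have "b \<in> ?R" if "b \<in> B" for b
  proof -
    have "(\<Sum>x\<in>B. (if x = b then 1 else 0) *\<^sub>R x) = (\<Sum>x\<in>B. if b = x then x else 0)"
      by (rule sum.cong) auto
    also have "\<dots> = b"
      using assms that by simp
    finally show ?thesis
      by (intro CollectI exI[of _ "\<lambda>x. if x = b then 1 else 0"]) auto
  qed
  then show "B \<subseteq> ?R" by blast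
  have "(\<Sum>b\<in>B. c b *\<^sub>R b) + (\<Sum>b\<in>B. d b *\<^sub>R b) \<in> ?R"
    if "\<forall>b\<in>B. 0 \<le> c b" "\<forall>b\<in>B. 0 \<le> d b" for c d
    using that by (intro CollectI exI[of _ "\<lambda>b. c b + d b"]) (auto simp: scaleR_add_left sum.distrib)
  moreover have "k *\<^sub>R (\<Sum>b\<in>B. c b *\<^sub>R b) \<in> ?R" if "\<forall>b\<in>B. 0 \<le> c b" "0 \<le> k" for c k
    using that by (intro CollectI exI[of _ "\<lambda>b. k * c b"]) (auto simp: scaleR_sum_right)
  moreover have "0 \<in> ?R"
    by (intro CollectI exI[of _ "\<lambda>b. 0"]) auto
  ultimately show "convex_cone ?R"
    unfolding convex_cone_iff by blast
next
  fix S assume S: "B \<subseteq> S" "convex_cone S"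
  have "(\<Sum>b\<in>A. c b *\<^sub>R b) \<in> S" if "finite A" "A \<subseteq> S" "\<forall>b\<in>A. 0 \<le> c b" for A c
    using that by (induction A rule: finite_induct)
      (auto simp: S convex_cone_contains_0 intro!: convex_cone_add convex_cone_scaleR)
  then show "?R \<subseteq> S"
    using S assms by auto
qed

text \<open>Writes a combination as a sum of two elements of the cone, the shape in which the
  additive property of faces can be applied to a single generator.\<close>

lemma convex_cone_hull_sum_remove:
  assumes "finite B" "b \<in> B" "\<forall>b\<in>B. 0 \<le> c b"
  obtains v where "v \<in> convex_cone hull B" "c b *\<^sub>R b \<in> convex_cone hull B"
    "(\<Sum>b\<in>B. c b *\<^sub>R b) = c b *\<^sub>R b + v"
proof
  have "(\<Sum>x\<in>B - {b}. c x *\<^sub>R x) \<in> convex_cone hull (B - {b})"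
    using assms by (auto simp: convex_cone_hull_finite)
  then show "(\<Sum>x\<in>B - {b}. c x *\<^sub>R x) \<in> convex_cone hull B"
    using hull_mono[of "B - {b}" B] by blast
  show "c b *\<^sub>R b \<in> convex_cone hull B"
    using assms by (intro convex_cone_hull_mul hull_inc) auto
  show "(\<Sum>x\<in>B. c x *\<^sub>R x) = c b *\<^sub>R b + (\<Sum>x\<in>B - {b}. c x *\<^sub>R x)"
    using assms(1,2) by (rule sum.remove)
qed

lemma convex_cone_hull_singleton: "convex_cone hull {u} = {r *\<^sub>R u | r. 0 \<le> r}"
  by (auto simp: convex_cone_hull_finite)

lemma convex_cone_hull_doubleton:
  "convex_cone hull {u, v} = {r *\<^sub>R u + s *\<^sub>R v | r s. 0 \<le> r \<and> 0 \<le> s}"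
  using convex_cone_hull_Un[of "{u}" "{v}"]
  by (auto simp: convex_cone_hull_singleton insert_is_Un[of u "{v}"])

lemma scaleR_mem_convex_cone_iff:
  assumes "convex_cone S" "0 < r"
  shows "r *\<^sub>R x \<in> S \<longleftrightarrow> x \<in> S"
proof
  assume "r *\<^sub>R x \<in> S"
  then show "x \<in> S"
    using assms convex_cone_scaleR[OF assms(1), of "1 / r" "r *\<^sub>R x"] by simp
qed (use assms in \<open>auto intro: convex_cone_scaleR\<close>)

lemma convex_cone_hull_doubleton_scaleR:
  assumes "0 < r" "0 < s"
  shows "convex_cone hull {r *\<^sub>R u, s *\<^sub>R v} = convex_cone hull {u, v}"
proof (rule antisym; rule hull_minimal)
  let ?K = "convex_cone hull {u, v}" and ?L = "convex_cone hull {r *\<^sub>R u, s *\<^sub>R v}"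
  have "u \<in> ?K" "v \<in> ?K" "r *\<^sub>R u \<in> ?L" "s *\<^sub>R v \<in> ?L"
    by (auto intro: hull_inc)
  then show "{r *\<^sub>R u, s *\<^sub>R v} \<subseteq> ?K" "{u, v} \<subseteq> ?L"
    using assms by (auto simp: scaleR_mem_convex_cone_iff convex_cone_convex_cone_hull)
qed (auto simp: convex_cone_convex_cone_hull)

section \<open>Faces of convex cones\<close>

lemma face_of_convex_cone:
  assumes "convex_cone S" "F face_of S" "F \<noteq> {}"
  shows "convex_cone F"
  using assms face_of_conic face_of_imp_convex unfolding convex_cone_def by blast

text \<open>For cones, segments can be traded for sums: \<open>u + v\<close> is the midpoint of the
  doubled vectors, which again lie in \<open>S\<close>.\<close>

lemma face_of_convex_cone_add:
  assumes S: "convex_cone S" and F: "F face_of S" and uv: "u \<in> S" "v \<in> S" "u + v \<in> F"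
  shows "u \<in> F"
proof -
  have cF: "convex_cone F"
    using face_of_convex_cone[OF S F] uv by blast
  have "2 *\<^sub>R u \<in> F"
  proof (cases "u = v")
    case True
    then show ?thesis using uv by (simp add: scaleR_2)
  next
    case False
    have "u + v = midpoint (2 *\<^sub>R u) (2 *\<^sub>R v)"
      by (simp add: midpoint_def scaleR_right_distrib)
    then have "u + v \<in> open_segment (2 *\<^sub>R u) (2 *\<^sub>R v)"
      using False by (simp add: midpoint_in_open_segment)
    moreover have "2 *\<^sub>R u \<in> S" "2 *\<^sub>R v \<in> S"
      using S uv by (auto intro: convex_cone_scaleR)
    ultimately show ?thesis
      using F uv unfolding face_of_def by blast
  qed
  then show ?thesis
    using cF by (simp add: scaleR_mem_convex_cone_iff)
qed

text \<open>Converse of the additive property: the coefficients of a convex combination are absorbed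
  into its two summands and removed again by scaling.\<close>

lemma face_of_convex_coneI:
  assumes "F \<subseteq> S" "convex_cone S" "convex_cone F"
    and add: "\<And>u v. u \<in> S \<Longrightarrow> v \<in> S \<Longrightarrow> u + v \<in> F \<Longrightarrow> u \<in> F"
  shows "F face_of S"
  unfolding face_of_def
proof (intro conjI ballI impI)
  show "F \<subseteq> S" "convex F"
    using assms by (auto simp: convex_cone_def)
  fix a b x assume ab: "a \<in> S" "b \<in> S" "x \<in> F" "x \<in> open_segment a b"
  then obtain r where r: "0 < r" "r < 1" "x = (1 - r) *\<^sub>R a + r *\<^sub>R b"
    by (auto simp: in_segment)
  then have "(1 - r) *\<^sub>R a \<in> S" "r *\<^sub>R b \<in> S"
    using ab assms by (auto intro: convex_cone_scaleR)
  with ab r have "(1 - r) *\<^sub>R a \<in> F" "r *\<^sub>R b \<in> F"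
    using add[of "(1 - r) *\<^sub>R a" "r *\<^sub>R b"] add[of "r *\<^sub>R b" "(1 - r) *\<^sub>R a"] by (auto simp: add.commute)
  then show "a \<in> F" "b \<in> F"
    using r assms by (auto simp: scaleR_mem_convex_cone_iff)
qed

text \<open>By independence the coefficients of \<open>u + v\<close> outside \<open>C\<close>
  vanish. There they are sums of nonnegative coefficients of \<open>u\<close> and \<open>v\<close>,
  so those of \<open>u\<close> vanish as well.\<close>

lemma simplicial_cone_face_of:
  assumes B: "finite B" "independent B" and C: "C \<subseteq> B"
  shows "convex_cone hull C face_of convex_cone hull B"
proof (rule face_of_convex_coneI)
  have fC: "finite C" using B C finite_subset by blast
  fix u v assume u: "u \<in> convex_cone hull B" and v: "v \<in> convex_cone hull B"
    and uv: "u + v \<in> convex_cone hull C"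
  obtain c where c: "u = (\<Sum>b\<in>B. c b *\<^sub>R b)" "\<forall>b\<in>B. 0 \<le> c b"
    using u B by (auto simp: convex_cone_hull_finite)
  obtain d where d: "v = (\<Sum>b\<in>B. d b *\<^sub>R b)" "\<forall>b\<in>B. 0 \<le> d b"
    using v B by (auto simp: convex_cone_hull_finite)
  obtain e where e: "u + v = (\<Sum>b\<in>C. e b *\<^sub>R b)"
    using uv fC by (auto simp: convex_cone_hull_finite)
  have "u + v = (\<Sum>b\<in>B. (if b \<in> C then e b else 0) *\<^sub>R b)"
    unfolding e using B C by (intro sum.mono_neutral_cong_left) auto
  then have "(\<Sum>b\<in>B. (c b + d b - (if b \<in> C then e b else 0)) *\<^sub>R b) = 0"
    by (simp add: c d scaleR_diff_left scaleR_add_left sum_subtractf sum.distrib)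
  then have "c b + d b - (if b \<in> C then e b else 0) = 0" if "b \<in> B" for b
    using B that independentD[of B B "\<lambda>b. c b + d b - (if b \<in> C then e b else 0)"] by auto
  then have "c b = 0" if "b \<in> B - C" for b
    using that c d by (smt (verit) DiffE)
  then have "u = (\<Sum>b\<in>C. c b *\<^sub>R b)"
    unfolding c using B C by (intro sum.mono_neutral_right) auto
  then show "u \<in> convex_cone hull C"
    using fC c C by (auto simp: convex_cone_hull_finite)
qed (use C in \<open>auto simp: convex_cone_convex_cone_hull hull_mono\<close>)

text \<open>A generator with positive coefficient in some point of \<open>F\<close> is, up to
  scaling, a summand of that point and hence lies in \<open>F\<close>.\<close>

lemma face_of_convex_cone_hull_finite:
  assumes B: "finite B" and F: "F face_of convex_cone hull B" "F \<noteq> {}"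
  shows "F = convex_cone hull (B \<inter> F)"
proof
  have cF: "convex_cone F"
    using F convex_cone_convex_cone_hull face_of_convex_cone by blast
  then show "convex_cone hull (B \<inter> F) \<subseteq> F"
    by (intro hull_minimal) auto
  show "F \<subseteq> convex_cone hull (B \<inter> F)"
  proof
    fix x assume x: "x \<in> F"
    then have "x \<in> convex_cone hull B"
      using F face_of_imp_subset by blast
    then obtain c where c: "x = (\<Sum>b\<in>B. c b *\<^sub>R b)" "\<forall>b\<in>B. 0 \<le> c b"
      using B by (auto simp: convex_cone_hull_finite)
    have "c b = 0" if b: "b \<in> B - F" for b
    proof (rule ccontr)
      assume "c b \<noteq> 0"
      then have pos: "0 < c b" using b c by (auto simp: order.strict_iff_order)
      obtain v where "v \<in> convex_cone hull B" "c b *\<^sub>R b \<in> convex_cone hull B"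
        "x = c b *\<^sub>R b + v"
        using convex_cone_hull_sum_remove[OF B _ c(2)] b c(1) by blast
      then have "c b *\<^sub>R b \<in> F"
        using face_of_convex_cone_add[OF convex_cone_convex_cone_hull F(1)] x by metis
      with pos cF b show False
        by (simp add: scaleR_mem_convex_cone_iff)
    qed
    then have "x = (\<Sum>b\<in>B \<inter> F. c b *\<^sub>R b)"
      unfolding c using B by (intro sum.mono_neutral_right) auto
    then show "x \<in> convex_cone hull (B \<inter> F)"
      using B c by (auto simp: convex_cone_hull_finite)
  qed
qed

section \<open>Overlaps and rays in a fan\<close>

lemma fan_convex_cone: "fan W \<Sigma> \<Longrightarrow> \<sigma> \<in> \<Sigma> \<Longrightarrow> convex_cone \<sigma>"
  by (auto simp: fan_def strongly_convex_cone_def)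

lemma fan_face: "fan W \<Sigma> \<Longrightarrow> \<sigma> \<in> \<Sigma> \<Longrightarrow> F face_of \<sigma> \<Longrightarrow> F \<noteq> {} \<Longrightarrow> F \<in> \<Sigma>"
  by (auto simp: fan_def polyhedral_complex_def)

lemma fan_Int_face_of:
  assumes "fan W \<Sigma>" "\<sigma> \<in> \<Sigma>" "\<tau> \<in> \<Sigma>"
  shows "\<sigma> \<inter> \<tau> face_of \<sigma>"
  using assms unfolding fan_def polyhedral_complex_def by (metis empty_face_of)

lemma fan_simplicial_face:
  assumes "fan W \<Sigma>" "convex_cone hull B \<in> \<Sigma>" "finite B" "independent B" "C \<subseteq> B"
  shows "convex_cone hull C \<in> \<Sigma>"
  using assms fan_face simplicial_cone_face_of convex_cone_hull_nonempty by metis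

text \<open>This form of the fan axiom rules out crossings: \<open>\<sigma> \<inter> \<tau>\<close>
  is a face of \<open>\<tau>\<close>, so a sum of points of \<open>\<tau>\<close> that falls into
  \<open>\<sigma>\<close> brings both summands along.\<close>

lemma fan_add_mem:
  assumes "fan W \<Sigma>" "\<sigma> \<in> \<Sigma>" "\<tau> \<in> \<Sigma>" "u \<in> \<tau>" "v \<in> \<tau>" "u + v \<in> \<sigma>"
  shows "u \<in> \<sigma>" "v \<in> \<sigma>"
proof -
  have *: "u \<in> \<sigma>" if "u \<in> \<tau>" "v \<in> \<tau>" "u + v \<in> \<sigma>" for u v
    using face_of_convex_cone_add[OF fan_convex_cone[OF assms(1,3)] fan_Int_face_of[OF assms(1,3,2)] that(1,2)]
      that convex_cone_add[OF fan_convex_cone[OF assms(1,3)]] by blast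
  show "u \<in> \<sigma>" "v \<in> \<sigma>"
    using *[of u v] *[of v u] assms by (auto simp: add.commute)
qed

text \<open>Any nonzero term in an expansion of \<open>p\<close> over \<open>B\<close> lies on the
  ray through \<open>p\<close>, by \<open>fan_add_mem\<close>. Its generator is therefore a positive
  multiple of \<open>p\<close>.\<close>

lemma fan_ray_generator:
  assumes fan: "fan W \<Sigma>" and \<sigma>: "convex_cone hull B \<in> \<Sigma>" "finite B"
    and p: "convex_cone hull {p} \<in> \<Sigma>" "p \<noteq> 0" "p \<in> convex_cone hull B"
  obtains r where "0 < r" "r *\<^sub>R p \<in> B"
proof -
  obtain c where c: "p = (\<Sum>b\<in>B. c b *\<^sub>R b)" "\<forall>b\<in>B. 0 \<le> c b"
    using p \<sigma> by (auto simp: convex_cone_hull_finite)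
  then obtain b where b: "b \<in> B" "c b *\<^sub>R b \<noteq> 0"
    using p(2) by (metis (no_types, lifting) sum.neutral)
  then have pos: "0 < c b" using c by (auto simp: order.strict_iff_order)
  obtain v where "v \<in> convex_cone hull B" "c b *\<^sub>R b \<in> convex_cone hull B"
    "p = c b *\<^sub>R b + v"
    using convex_cone_hull_sum_remove[OF \<sigma>(2) b(1) c(2)] c(1) by blast
  moreover have "p \<in> convex_cone hull {p}"
    by (simp add: hull_inc)
  ultimately have "c b *\<^sub>R b \<in> convex_cone hull {p}"
    using fan_add_mem(1)[OF fan p(1) \<sigma>(1)] by metis
  then obtain s where s: "0 \<le> s" "c b *\<^sub>R b = s *\<^sub>R p"
    by (auto simp: convex_cone_hull_singleton)
  with b have "0 < s" by (auto simp: order.strict_iff_order)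
  moreover have "b = (s / c b) *\<^sub>R p"
    using s pos by (metis divide_inverse_commute less_numeral_extra(3) real_vector.scale_scale scaleR_one left_inverse)
  ultimately show thesis
    using that[of "s / c b"] b pos by auto
qed

text \<open>Builds a complex from a finite family \<open>M\<close> of cells. Intersections need to
  be checked in \<open>M\<close> only, since \<open>face_of_Int_subface\<close> passes them down to
  the faces.\<close>

lemma polyhedral_complex_faces:
  assumes M: "finite M"
    and faces: "\<And>\<sigma> F. \<sigma> \<in> M \<Longrightarrow> F face_of \<sigma> \<Longrightarrow> F \<noteq> {} \<Longrightarrow> polyhedron_in W F"
    and gen: "\<And>\<sigma>. \<sigma> \<in> M \<Longrightarrow> finite {F. F face_of \<sigma>}"
    and Int: "\<And>\<sigma> \<tau>. \<sigma> \<in> M \<Longrightarrow> \<tau> \<in> M \<Longrightarrow> \<sigma> \<inter> \<tau> face_of \<sigma>"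
  shows "polyhedral_complex W {F. F \<noteq> {} \<and> (\<exists>\<sigma>\<in>M. F face_of \<sigma>)}"
  unfolding polyhedral_complex_def
proof (intro conjI ballI allI impI)
  have "finite (\<Union>\<sigma>\<in>M. {F. F face_of \<sigma>})"
    using M gen by auto
  then show "finite {F. F \<noteq> {} \<and> (\<exists>\<sigma>\<in>M. F face_of \<sigma>)}"
    by (rule rev_finite_subset) auto
next
  fix P Q assume "P \<in> {F. F \<noteq> {} \<and> (\<exists>\<sigma>\<in>M. F face_of \<sigma>)}" "Q \<in> {F. F \<noteq> {} \<and> (\<exists>\<sigma>\<in>M. F face_of \<sigma>)}"
  then obtain \<sigma> \<tau> where "\<sigma> \<in> M" "\<tau> \<in> M" "P face_of \<sigma>" "Q face_of \<tau>" by auto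
  then have "(P \<inter> Q) face_of P \<and> (P \<inter> Q) face_of Q"
    using Int[of \<sigma> \<tau>] Int[of \<tau> \<sigma>] by (intro face_of_Int_subface[of \<sigma> \<tau>]) (auto simp: Int_commute)
  then show "P \<inter> Q = {} \<or> P \<inter> Q face_of P \<and> P \<inter> Q face_of Q" by blast
qed (use faces face_of_trans in blast)+

lemma nonneg_of_le_mult:
  fixes a x t :: real
  assumes "0 \<le> x" "x \<le> a * t" "0 < a"
  shows "0 \<le> t"
proof -
  have "0 \<le> a * t" using assms by simp
  with assms(3) show ?thesis by (simp add: zero_le_mult_iff)
qed

lemma admissible_cone_imp_polyhedron_in:
  assumes "admissible_cone \<Gamma> N \<sigma>"
  shows "polyhedron_in (span N \<times> UNIV) \<sigma>"
proof -
  from assms obtain l :: nat and u \<gamma> where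
    u: "\<forall>i\<in>{1..l}. u i \<in> dual_lattice N \<and> \<gamma> i \<in> \<Gamma>"
    and eq: "\<sigma> = {(w, t) \<in> half_space N. \<forall>i\<in>{1..l}. u i w + \<gamma> i * t \<ge> 0}"
    unfolding admissible_cone_def by (elim conjE exE) (rule that)
  \<comment> \<open>The height condition hidden in \<open>half_space\<close> becomes the inequality
    \<open>(snd, 0)\<close>.\<close>
  define H :: "(('a \<times> real \<Rightarrow> real) \<times> real) set" where
    "H = insert (snd, 0) ((\<lambda>i. (\<lambda>v. u i (fst v) + \<gamma> i * snd v, 0)) ` {1..l})"
  have "linear (\<lambda>v. u i (fst v) + \<gamma> i * snd v)" if "i \<in> {1..l}" for i
    using u that
    by (intro linearI) (auto simp: dual_lattice_def linear_add linear_scale algebra_simps)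
  then have "\<forall>(f, c)\<in>H. linear f"
    by (auto simp: H_def linear_snd)
  moreover have "\<sigma> = {v \<in> span N \<times> UNIV. \<forall>(f, c)\<in>H. f v \<ge> c}"
    unfolding eq by (auto simp: H_def half_space_def)
  moreover have "finite H" by (simp add: H_def)
  ultimately show ?thesis
    unfolding polyhedron_in_def by blast
qed

text \<open>An inequality of a cone restricted to a parabola is such a quadratic, and its linear
  part is the restriction to the tangent. Infinitely many nonnegative values force
  \<open>A \<ge> 0\<close> in the limit, and \<open>B \<ge> 0\<close> in case
  \<open>A = 0\<close>.\<close>

lemma quadratic_nonneg_imp_linear_nonneg:
  fixes A B C :: real
  assumes inf: "infinite {n. 0 \<le> A + inverse (real (Suc n)) * B + (inverse (real (Suc n)))\<^sup>2 * C}"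
  shows "\<forall>\<^sub>F \<epsilon> in at_right 0. 0 \<le> A + \<epsilon> * B"
proof -
  let ?s = "\<lambda>n. inverse (real (Suc n))"
  have s: "?s \<longlonglongrightarrow> 0" by (rule LIMSEQ_inverse_real_of_nat)
  have neg: False if "\<forall>\<^sub>F n in sequentially. A + ?s n * B + (?s n)\<^sup>2 * C < 0"
  proof -
    have "finite {n. \<not> A + ?s n * B + (?s n)\<^sup>2 * C < 0}"
      using that by (simp add: cofinite_eq_sequentially[symmetric] eventually_cofinite)
    with inf show False by (simp add: not_less)
  qed
  have "(\<lambda>n. A + ?s n * B + (?s n)\<^sup>2 * C) \<longlonglongrightarrow> A + 0 * B + 0\<^sup>2 * C"
    by (intro tendsto_intros s)
  then have A: "0 \<le> A"
    using neg order_tendstoD(2)[of _ A sequentially 0] by fastforce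
  show ?thesis
  proof (cases "A = 0")
    case True
    have "(\<lambda>n. B + ?s n * C) \<longlonglongrightarrow> B + 0 * C"
      by (intro tendsto_intros s)
    then have lt: "\<forall>\<^sub>F n in sequentially. B + ?s n * C < 0" if "B < 0"
      using that order_tendstoD(2)[of _ B sequentially 0] by fastforce
    have "\<forall>\<^sub>F n in sequentially. A + ?s n * B + (?s n)\<^sup>2 * C < 0" if neg: "B < 0"
    proof (rule eventually_mono)
      show "\<forall>\<^sub>F n in sequentially. B + ?s n * C < 0" using lt neg .
    next
      fix n assume "B + ?s n * C < 0"
      then have "?s n * (B + ?s n * C) < 0" by (intro mult_pos_neg) auto
      then show "A + ?s n * B + (?s n)\<^sup>2 * C < 0"
        using True by (simp add: power2_eq_square algebra_simps)
    qed
    then have "0 \<le> B" using neg by fastforce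
    with True show ?thesis
      by (auto intro!: eventually_at_right_less[THEN eventually_mono] mult_nonneg_nonneg)
  next
    case False
    with A have "0 < A" by simp
    moreover have "((\<lambda>\<epsilon>. A + \<epsilon> * B) \<longlongrightarrow> A + 0 * B) (at_right 0)"
      by (intro tendsto_intros)
    ultimately show ?thesis
      by (auto dest!: order_tendstoD(1)[where a = 0] elim: eventually_mono)
  qed
qed

subsection \<open>A rank two lattice\<close>

text \<open>A dual pair of functionals allows the plane to sit in an ambient space of any dimension.
  \<open>X\<close> and \<open>Y\<close> read off coordinates, yield the independence of
  \<open>e1\<close> and \<open>e2\<close>, and later provide elements of the dual lattice.\<close>

locale lattice_plane =
  fixes e1 e2 :: "'v::real_vector" and X Y :: "'v \<Rightarrow> real"
  assumes lin: "linear X" "linear Y"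
    and dual [simp]: "X e1 = 1" "X e2 = 0" "Y e1 = 0" "Y e2 = 1"
begin

definition lat :: "'v set" where
  "lat = {of_int m *\<^sub>R e1 + of_int n *\<^sub>R e2 | m n. True}"

definition pt :: "real \<Rightarrow> real \<Rightarrow> real \<Rightarrow> 'v \<times> real" where
  "pt x y t = (x *\<^sub>R e1 + y *\<^sub>R e2, t)"

text \<open>The cone over a segment at height 1. Segments in the slice and these cones are two views
  of the same object.\<close>

abbreviation edge :: "real \<Rightarrow> real \<Rightarrow> real \<Rightarrow> real \<Rightarrow> ('v \<times> real) set" where
  "edge x y x' y' \<equiv> convex_cone hull {pt x y 1, pt x' y' 1}"

lemma lin_simps [simp]:
  "X (v + w) = X v + X w" "X (r *\<^sub>R v) = r * X v"
  "Y (v + w) = Y v + Y w" "Y (r *\<^sub>R v) = r * Y v"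
  using lin by (auto simp: linear_add linear_scale)

lemma X_Y_pt [simp]: "X (fst (pt x y t)) = x" "Y (fst (pt x y t)) = y" "snd (pt x y t) = t"
  by (auto simp: pt_def)

lemma pt_eq_iff [simp]: "pt x y t = pt x' y' t' \<longleftrightarrow> x = x' \<and> y = y' \<and> t = t'"
  by (metis X_Y_pt)

lemma pt_add [simp]: "pt x y t + pt x' y' t' = pt (x + x') (y + y') (t + t')"
  by (simp add: pt_def scaleR_add_left)

lemma pt_scaleR [simp]: "r *\<^sub>R pt x y t = pt (r * x) (r * y) (r * t)"
  by (simp add: pt_def scaleR_add_right)

lemma pt_eq_0_iff [simp]: "pt x y t = 0 \<longleftrightarrow> x = 0 \<and> y = 0 \<and> t = 0"
proof -
  have "pt 0 0 0 = 0" by (simp add: pt_def zero_prod_def)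
  then show ?thesis by (metis pt_eq_iff)
qed

lemma e1_neq_e2: "e1 \<noteq> e2"
  by (metis dual zero_neq_one)

lemma independent_e: "independent {e1, e2}"
proof (rule independent_if_scalars_zero)
  fix f x assume s: "(\<Sum>x\<in>{e1, e2}. f x *\<^sub>R x) = 0" and x: "x \<in> {e1, e2}"
  then have "f e1 *\<^sub>R e1 + f e2 *\<^sub>R e2 = 0" using e1_neq_e2 by simp
  then have "X (f e1 *\<^sub>R e1 + f e2 *\<^sub>R e2) = X 0" "Y (f e1 *\<^sub>R e1 + f e2 *\<^sub>R e2) = Y 0" by auto
  then show "f x = 0" using x lin by (auto simp: linear_0)
qed auto

lemma is_lattice_lat: "is_lattice lat"
  unfolding is_lattice_def
proof (intro exI[of _ "{e1, e2}"] conjI)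
  show "lat = range (\<lambda>c::'v \<Rightarrow> int. \<Sum>b\<in>{e1, e2}. of_int (c b) *\<^sub>R b)"
  proof (intro equalityI subsetI)
    fix v assume "v \<in> lat"
    then obtain m n where v: "v = of_int m *\<^sub>R e1 + of_int n *\<^sub>R e2" by (auto simp: lat_def)
    show "v \<in> range (\<lambda>c::'v \<Rightarrow> int. \<Sum>b\<in>{e1, e2}. of_int (c b) *\<^sub>R b)"
      using e1_neq_e2 by (intro range_eqI[of _ _ "\<lambda>b. if b = e1 then m else n"]) (auto simp: v)
  qed (use e1_neq_e2 in \<open>auto simp: lat_def\<close>)
qed (simp_all add: independent_e)

lemma basis_in_lat: "e1 \<in> lat" "e2 \<in> lat"
proof -
  have "e1 = of_int 1 *\<^sub>R e1 + of_int 0 *\<^sub>R e2" "e2 = of_int 0 *\<^sub>R e1 + of_int 1 *\<^sub>R e2" by auto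
  then show "e1 \<in> lat" "e2 \<in> lat" unfolding lat_def by blast+
qed

lemma span_lat: "span lat = {x *\<^sub>R e1 + y *\<^sub>R e2 | x y. True}"
proof -
  have "span {e1, e2} \<subseteq> span lat" using basis_in_lat by (intro span_mono) auto
  moreover have "lat \<subseteq> span {e1, e2}"
    unfolding lat_def by (auto intro!: span_add intro: span_scale span_base)
  ultimately have "span lat = span {e1, e2}" by (metis antisym span_minimal subspace_span)
  also have "\<dots> = {x *\<^sub>R e1 + y *\<^sub>R e2 | x y. True}"
    by (auto simp: span_insert algebra_simps)
  finally show ?thesis .
qed

lemma half_space_lat: "half_space lat = {pt x y t | x y t. 0 \<le> t}"
  by (auto simp: half_space_def span_lat pt_def)

lemma pt_mem_half_space [simp]: "pt x y t \<in> half_space lat \<longleftrightarrow> 0 \<le> t"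
  by (auto simp: half_space_lat)

lemma half_spaceE:
  assumes "v \<in> half_space lat"
  obtains x y t where "v = pt x y t" "0 \<le> t"
  using assms by (auto simp: half_space_lat)

lemma independent_pt:
  assumes "(x, y) \<noteq> (x', y')"
  shows "independent {pt x y 1, pt x' y' 1}"
proof (rule independent_if_scalars_zero)
  fix f v assume s: "(\<Sum>v\<in>{pt x y 1, pt x' y' 1}. f v *\<^sub>R v) = 0" and v: "v \<in> {pt x y 1, pt x' y' 1}"
  define r r' where "r = f (pt x y 1)" and "r' = f (pt x' y' 1)"
  from s have *: "r + r' = 0" "r * x + r' * x' = 0" "r * y + r' * y' = 0"
    using assms by (auto simp: r_def r'_def)
  then have "r' = - r" by simp
  with * have "r * (x - x') = 0" "r * (y - y') = 0"
    by (auto simp: algebra_simps)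
  with \<open>r' = - r\<close> have "r = 0" "r' = 0" using assms by auto
  then show "f v = 0" using v by (auto simp: r_def r'_def)
qed auto

section \<open>The three kinds of segments in coordinates\<close>

lemma edge_mem_iff: "v \<in> edge x y x' y' \<longleftrightarrow>
   (\<exists>r s. 0 \<le> r \<and> 0 \<le> s \<and> v = pt (r * x + s * x') (r * y + s * y') (r + s))"
  by (auto simp: convex_cone_hull_doubleton)

text \<open>The weights of the two generators are \<open>t - x / a\<close> and \<open>x / a\<close>.
  The bounds on \<open>x\<close> already imply \<open>0 \<le> t\<close>.\<close>

lemma horizontal_edge_mem_iff:
  assumes "0 < a" shows "pt x y t \<in> edge 0 0 a 0 \<longleftrightarrow> y = 0 \<and> 0 \<le> x \<and> x \<le> a * t"
proof
  assume "y = 0 \<and> 0 \<le> x \<and> x \<le> a * t"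
  then show "pt x y t \<in> edge 0 0 a 0"
    using assms unfolding edge_mem_iff by (intro exI[of _ "t - x / a"] exI[of _ "x / a"]) (auto simp: field_simps)
qed (use assms in \<open>auto simp: edge_mem_iff algebra_simps\<close>)

lemma vertical_edge_mem_iff:
  assumes "0 < b" shows "pt x y t \<in> edge 0 0 0 b \<longleftrightarrow> x = 0 \<and> 0 \<le> y \<and> y \<le> b * t"
proof
  assume "x = 0 \<and> 0 \<le> y \<and> y \<le> b * t"
  then show "pt x y t \<in> edge 0 0 0 b"
    using assms unfolding edge_mem_iff by (intro exI[of _ "t - y / b"] exI[of _ "y / b"]) (auto simp: field_simps)
qed (use assms in \<open>auto simp: edge_mem_iff algebra_simps\<close>)

lemma diagonal_edge_mem_iff:
  assumes "0 < c" shows "pt x y t \<in> edge c 0 0 c \<longleftrightarrow> 0 \<le> x \<and> 0 \<le> y \<and> x + y = c * t"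
proof
  assume "0 \<le> x \<and> 0 \<le> y \<and> x + y = c * t"
  then show "pt x y t \<in> edge c 0 0 c"
    using assms unfolding edge_mem_iff by (intro exI[of _ "x / c"] exI[of _ "y / c"]) (auto simp: field_simps)
qed (use assms in \<open>auto simp: edge_mem_iff algebra_simps\<close>)

section \<open>Integer coefficients and rational slopes\<close>

lemma admissible_coneE:
  assumes "admissible_cone \<Gamma> lat \<sigma>"
  obtains l :: nat and m n :: "nat \<Rightarrow> int" and \<gamma> where
    "\<forall>x y t. pt x y t \<in> \<sigma> \<longleftrightarrow> 0 \<le> t \<and> (\<forall>i\<in>{1..l}. 0 \<le> of_int (m i) * x + of_int (n i) * y + \<gamma> i * t)"
proof -
  from assms obtain l :: nat and u \<gamma> where
    u: "\<forall>i\<in>{1..l}. u i \<in> dual_lattice lat \<and> \<gamma> i \<in> \<Gamma>"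
    and eq: "\<sigma> = {(w, t) \<in> half_space lat. \<forall>i\<in>{1..l}. u i w + \<gamma> i * t \<ge> 0}"
    unfolding admissible_cone_def by (elim conjE exE) (rule that)
  have "\<forall>i\<in>{1..l}. \<exists>m::int. u i e1 = of_int m" "\<forall>i\<in>{1..l}. \<exists>n::int. u i e2 = of_int n"
    using u basis_in_lat by (auto simp: dual_lattice_def image_subset_iff Ints_def)
  then obtain m n :: "nat \<Rightarrow> int" where mn: "\<forall>i\<in>{1..l}. u i e1 = of_int (m i)" "\<forall>i\<in>{1..l}. u i e2 = of_int (n i)"
    by (auto dest!: bchoice)
  have val: "u i (x *\<^sub>R e1 + y *\<^sub>R e2) = of_int (m i) * x + of_int (n i) * y" if "i \<in> {1..l}" for i x y
    using u mn that by (simp add: dual_lattice_def linear_add linear_scale)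
  have "pt x y t \<in> \<sigma> \<longleftrightarrow> pt x y t \<in> half_space lat \<and> (\<forall>i\<in>{1..l}. 0 \<le> u i (x *\<^sub>R e1 + y *\<^sub>R e2) + \<gamma> i * t)" for x y t
    unfolding eq pt_def by simp
  with val show thesis
    by (intro that[of l m n \<gamma>]) simp
qed

text \<open>The source of all rationality: \<open>(m, n)\<close> is an integer normal of the
  segment, taken from an inequality of the cone that vanishes on both endpoints.\<close>

lemma admissible_edge_rational_slope:
  assumes adm: "admissible_cone \<Gamma> lat (edge x y x' y')" and ne: "(x, y) \<noteq> (x', y')"
  obtains m n :: int where "(m, n) \<noteq> (0, 0)" "of_int m * (x' - x) + of_int n * (y' - y) = 0"
proof -
  obtain l :: nat and m n :: "nat \<Rightarrow> int" and \<gamma> where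
    mem': "\<forall>x0 y0 t. pt x0 y0 t \<in> edge x y x' y' \<longleftrightarrow>
      0 \<le> t \<and> (\<forall>i\<in>{1..l}. 0 \<le> of_int (m i) * x0 + of_int (n i) * y0 + \<gamma> i * t)"
    using admissible_coneE[OF adm] .
  define f where "f i x y t = of_int (m i) * x + of_int (n i) * y + \<gamma> i * t" for i x y t
  have mem: "pt x0 y0 t \<in> edge x y x' y' \<longleftrightarrow> 0 \<le> t \<and> (\<forall>i\<in>{1..l}. f i x0 y0 t \<ge> 0)" for x0 y0 t
    using mem' by (simp add: f_def)
  have f1: "f i x y 1 \<ge> 0" "f i x' y' 1 \<ge> 0" if "i \<in> {1..l}" for i
    using mem[of x y 1] mem[of x' y' 1] that by (auto intro: hull_inc)
  \<comment> \<open>If no inequality tight at the midpoint rejected the normal direction (p, q), the midpoint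
    could be moved out of the edge inside the cone.  An inequality that does reject it is not
    constant and vanishes on the edge.\<close>
  define p q where "p = y' - y" and "q = x - x'"
  \<comment> \<open>The sum of the endpoints, at height 2, stands for the midpoint and avoids
    fractions. The direction \<open>(p, q)\<close> has height 0.\<close>
  have "\<exists>i\<in>{1..l}. f i (x + x') (y + y') 2 = 0 \<and> f i p q 0 < 0"
  proof (rule ccontr)
    assume *: "\<not> ?thesis"
    have "\<forall>\<^sub>F \<epsilon> in at_right 0. \<forall>i\<in>{1..l}. 0 \<le> f i (x + x') (y + y') 2 + \<epsilon> * f i p q 0"
    proof (rule eventually_ball_finite, simp, intro ballI)
      fix i assume i: "i \<in> {1..l}"
      have "f i (x + x') (y + y') 2 = f i x y 1 + f i x' y' 1" by (simp add: f_def algebra_simps)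
      then have ge: "f i (x + x') (y + y') 2 \<ge> 0" using f1[OF i] by simp
      show "\<forall>\<^sub>F \<epsilon> in at_right 0. 0 \<le> f i (x + x') (y + y') 2 + \<epsilon> * f i p q 0"
      proof (cases "f i (x + x') (y + y') 2 = 0")
        case True
        with * i have "f i p q 0 \<ge> 0" by force
        with True show ?thesis
          by (auto intro!: eventually_at_right_less[THEN eventually_mono] mult_nonneg_nonneg)
      next
        case False
        with ge have "0 < f i (x + x') (y + y') 2" by simp
        moreover have "((\<lambda>\<epsilon>. f i (x + x') (y + y') 2 + \<epsilon> * f i p q 0) \<longlongrightarrow> f i (x + x') (y + y') 2 + 0 * f i p q 0) (at_right 0)"
          by (intro tendsto_intros)
        ultimately show ?thesis
          by (auto dest!: order_tendstoD(1)[where a = 0] elim: eventually_mono)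
      qed
    qed
    then have "\<forall>\<^sub>F \<epsilon> in at_right 0. 0 < \<epsilon> \<and> (\<forall>i\<in>{1..l}. 0 \<le> f i (x + x') (y + y') 2 + \<epsilon> * f i p q 0)"
      by (intro eventually_conj eventually_at_right_less)
    from eventually_happens'[OF trivial_limit_at_right_real this]
    obtain \<epsilon> where e: "\<epsilon> > 0" "\<forall>i\<in>{1..l}. 0 \<le> f i (x + x') (y + y') 2 + \<epsilon> * f i p q 0" by blast
    have "f i (x + x' + \<epsilon> * p) (y + y' + \<epsilon> * q) 2 = f i (x + x') (y + y') 2 + \<epsilon> * f i p q 0" for i
      by (simp add: f_def algebra_simps)
    with e have "pt (x + x' + \<epsilon> * p) (y + y' + \<epsilon> * q) 2 \<in> edge x y x' y'"
      by (simp add: mem)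
    then obtain r s where rs: "x + x' + \<epsilon> * p = r * x + s * x'" "y + y' + \<epsilon> * q = r * y + s * y'" "r + s = 2"
      by (auto simp: edge_mem_iff)
    then have s: "s = 2 - r" by simp
    \<comment> \<open>The displacement would be \<open>r - 1\<close> times the edge direction
      \<open>(q, - p)\<close>. As \<open>(p, q)\<close> is orthogonal to that direction, it would be
      zero.\<close>
    have "\<epsilon> * p = (r - 1) * q" "\<epsilon> * q = (1 - r) * p"
      using rs(1,2) unfolding s p_def q_def by (simp_all add: algebra_simps)
    then have "q * (\<epsilon> * q) + p * (\<epsilon> * p) = q * ((1 - r) * p) + p * ((r - 1) * q)"
      by (simp only:)
    then have "\<epsilon> * (p * p + q * q) = 0"
      by (simp add: algebra_simps)
    then have "p * p + q * q = 0" using e by simp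
    then show False using ne by (auto simp: p_def q_def sum_squares_eq_zero_iff)
  qed
  then obtain i where i: "i \<in> {1..l}" "f i (x + x') (y + y') 2 = 0" "f i p q 0 < 0" by blast
  have sum: "f i (x + x') (y + y') 2 = f i x y 1 + f i x' y' 1" by (simp add: f_def algebra_simps)
  with i f1[OF i(1)] have "f i x y 1 = 0" "f i x' y' 1 = 0" by auto
  then have "of_int (m i) * (x' - x) + of_int (n i) * (y' - y) = 0" by (simp add: f_def algebra_simps)
  moreover have "(m i, n i) \<noteq> (0, 0)" using i(3) by (auto simp: f_def)
  ultimately show thesis using that by blast
qed

subsection \<open>Turning around the origin in a completion\<close>

text \<open>One counterclockwise turn from \<open>(x, y)\<close> to the next vertex; the strict
  inequality records the orientation. A cell touching the left side of the given edge near the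
  origin contains that edge and has a further generator on the left. The vertical edge keeps this
  generator in the quadrant, and the diagonal one keeps it off height 0.\<close>

lemma completion_next_vertex:
  assumes fan: "half_space_fan lat \<Sigma>" and complete: "complete_fan lat \<Sigma>"
    and simpl: "simplicial_fan \<Sigma>" and adm: "admissible_fan \<Gamma> lat \<Sigma>"
    and Eb: "edge 0 0 0 b \<in> \<Sigma>" "0 < b" and Ec: "edge c 0 0 c \<in> \<Sigma>" "0 < c"
    and Eg: "edge 0 0 x y \<in> \<Sigma>" and x: "0 < x" and y: "0 \<le> y"
  obtains x' y' where "0 \<le> x'" "0 \<le> y'" "y * x' < x * y'"
    "edge 0 0 x' y' \<in> \<Sigma>" "edge x y x' y' \<in> \<Sigma>"
proof -
  have F: "fan (span lat \<times> UNIV) \<Sigma>" and half: "\<And>\<sigma>. \<sigma> \<in> \<Sigma> \<Longrightarrow> \<sigma> \<subseteq> half_space lat"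
    using fan by (auto simp: half_space_fan_def)
  have ind: "independent {pt 0 0 1, pt x y 1}"
    using x by (intro independent_pt) auto
  have rays: "convex_cone hull {pt 0 0 1} \<in> \<Sigma>" "convex_cone hull {pt x y 1} \<in> \<Sigma>"
    by (rule fan_simplicial_face[OF F Eg _ ind]; simp)+
  \<comment> \<open>The points \<open>q n\<close> approach the origin along a parabola tangent to the given edge, on the
    counterclockwise side.\<close>
  define q where "q n = pt (inverse (real (Suc n)) * x)
    (inverse (real (Suc n)) * (y + inverse (real (Suc n)))) 1" for n
  have "q n \<in> half_space lat" for n
    by (simp add: q_def)
  then have "\<exists>\<sigma>\<in>\<Sigma>. q n \<in> \<sigma>" for n
    using complete by (metis UnionE complete_fan_def)
  moreover have "finite \<Sigma>"
    using F by (auto simp: fan_def polyhedral_complex_def)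
  ultimately obtain \<sigma> where \<sigma>: "\<sigma> \<in> \<Sigma>" and inf: "infinite {n. q n \<in> \<sigma>}"
    using pigeonhole_infinite_rel[of "UNIV :: nat set" \<Sigma> "\<lambda>n \<sigma>. q n \<in> \<sigma>"] by auto
  \<comment> \<open>Each inequality of \<open>\<sigma>\<close> holds at infinitely many points of
    the parabola, hence on the tangent close to the origin. There are finitely many inequalities, so
    one \<open>\<epsilon>\<close> serves all; \<open>\<epsilon> < 1\<close> puts the point strictly
    inside the given edge.\<close>
  obtain \<epsilon> where \<epsilon>: "0 < \<epsilon>" "\<epsilon> < 1" "pt (\<epsilon> * x) (\<epsilon> * y) 1 \<in> \<sigma>"
  proof -
    obtain l :: nat and m n :: "nat \<Rightarrow> int" and \<gamma> where
      mem: "\<forall>x y t. pt x y t \<in> \<sigma> \<longleftrightarrow>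
        0 \<le> t \<and> (\<forall>i\<in>{1..l}. 0 \<le> of_int (m i) * x + of_int (n i) * y + \<gamma> i * t)"
      using admissible_coneE adm \<sigma> unfolding admissible_fan_def by blast
    have "\<forall>\<^sub>F \<epsilon> in at_right 0. \<forall>i\<in>{1..l}. 0 \<le> \<gamma> i + \<epsilon> * (of_int (m i) * x + of_int (n i) * y)"
    proof (rule eventually_ball_finite, simp, intro ballI)
      fix i assume i: "i \<in> {1..l}"
      let ?N = "{k. 0 \<le> \<gamma> i + inverse (real (Suc k)) * (of_int (m i) * x + of_int (n i) * y) +
         (inverse (real (Suc k)))\<^sup>2 * of_int (n i)}"
      have "k \<in> ?N" if "q k \<in> \<sigma>" for k
        using that i unfolding q_def mem[rule_format] by (auto simp: algebra_simps power2_eq_square)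
      then have "infinite ?N"
        using inf finite_subset[of "{n. q n \<in> \<sigma>}" ?N] by blast
      then show "\<forall>\<^sub>F \<epsilon> in at_right 0. 0 \<le> \<gamma> i + \<epsilon> * (of_int (m i) * x + of_int (n i) * y)"
        by (rule quadratic_nonneg_imp_linear_nonneg)
    qed
    moreover have "\<forall>\<^sub>F \<epsilon> in at_right 0. \<epsilon> \<in> {0<..<1::real}"
      by (rule eventually_at_right_real) simp
    ultimately have "\<forall>\<^sub>F \<epsilon> in at_right 0. \<epsilon> \<in> {0<..<1::real} \<and>
        (\<forall>i\<in>{1..l}. 0 \<le> \<gamma> i + \<epsilon> * (of_int (m i) * x + of_int (n i) * y))"
      by eventually_elim auto
    from eventually_happens'[OF trivial_limit_at_right_real this]
    obtain \<epsilon> :: real where "0 < \<epsilon>" "\<epsilon> < 1" "\<forall>i\<in>{1..l}. 0 \<le> \<gamma> i + \<epsilon> * (of_int (m i) * x + of_int (n i) * y)" by auto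
    then show thesis
      using that[of \<epsilon>] unfolding mem[rule_format] by (auto simp: algebra_simps)
  qed
  have c\<sigma>: "convex_cone \<sigma>" using fan_convex_cone[OF F \<sigma>] .
  \<comment> \<open>The inner point is split along the two endpoints with positive weights, so that
    \<open>\<sigma>\<close> absorbs both endpoints.\<close>
  have "pt 0 0 (1 - \<epsilon>) \<in> edge 0 0 x y" "pt (\<epsilon> * x) (\<epsilon> * y) \<epsilon> \<in> edge 0 0 x y"
    unfolding edge_mem_iff using \<epsilon> by (auto intro: exI[of _ "1 - \<epsilon>"] exI[of _ 0] exI[of _ \<epsilon>])
  from fan_add_mem[OF F \<sigma> Eg this] have "pt 0 0 (1 - \<epsilon>) \<in> \<sigma>" "pt (\<epsilon> * x) (\<epsilon> * y) \<epsilon> \<in> \<sigma>"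
    using \<epsilon> by auto
  then have p\<sigma>: "pt 0 0 1 \<in> \<sigma>" "pt x y 1 \<in> \<sigma>"
    using scaleR_mem_convex_cone_iff[OF c\<sigma>, of "1 - \<epsilon>" "pt 0 0 1"]
      scaleR_mem_convex_cone_iff[OF c\<sigma>, of \<epsilon> "pt x y 1"] \<epsilon> by auto
  obtain B where B: "finite B" "independent B" "\<sigma> = convex_cone hull B"
    using simpl \<sigma> by (auto simp: simplicial_fan_def)
  obtain r1 where r1: "0 < r1" "r1 *\<^sub>R pt 0 0 1 \<in> B"
    using fan_ray_generator[OF F _ B(1) rays(1)] \<sigma> B p\<sigma> by auto
  obtain r2 where r2: "0 < r2" "r2 *\<^sub>R pt x y 1 \<in> B"
    using fan_ray_generator[OF F _ B(1) rays(2)] \<sigma> B p\<sigma> by auto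
  \<comment> \<open>The determinant of \<open>(x, y)\<close> with the horizontal part of
    \<open>v\<close>: zero on the given edge, positive on its left. At \<open>q n\<close> it is
    \<open>x\<close> divided by the square of \<open>n + 1\<close>, so some generator must have a
    positive value too.\<close>
  define D where "D v = x * Y (fst v) - y * X (fst v)" for v :: "'v \<times> real"
  have D: "D (r *\<^sub>R v + w) = r * D v + D w" for r v w
    by (simp add: D_def algebra_simps)
  have "D 0 = 0" using D[of 1 0 0] by simp
  obtain n where "q n \<in> \<sigma>" using inf by (metis (mono_tags, lifting) empty_iff finite.emptyI mem_Collect_eq subsetI subset_empty)
  moreover have "0 < D (q n)"
    using x by (simp add: D_def q_def algebra_simps)
  ultimately obtain g where g: "(\<Sum>b\<in>B. g b *\<^sub>R b) = q n" "\<forall>b\<in>B. 0 \<le> g b" "0 < D (\<Sum>b\<in>B. g b *\<^sub>R b)"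
    using B by (auto simp: convex_cone_hull_finite)
  have "D (\<Sum>b\<in>A. g b *\<^sub>R b) = (\<Sum>b\<in>A. g b * D b)" if "finite A" for A
    using that by induction (auto simp: D \<open>D 0 = 0\<close>)
  from this[OF B(1)] g(3) have "0 < (\<Sum>b\<in>B. g b * D b)" by (simp only:)
  then obtain w where w: "w \<in> B" "0 < g w * D w"
    by (meson not_le sum_nonpos)
  have "0 \<le> g w" using g(2) w(1) by blast
  with w(2) have Dw: "0 < D w" by (auto simp: zero_less_mult_iff)
  obtain x' y' t' where w': "w = pt x' y' t'" "0 \<le> t'"
  proof -
    have "w \<in> \<sigma>" using w(1) unfolding B(3) by (rule hull_inc)
    then have "w \<in> half_space lat" using half[OF \<sigma>] by blast
    then show thesis by (rule half_spaceE) (rule that)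
  qed
  have det: "y * x' < x * y'" using Dw by (simp add: D_def w')
  have sub: "convex_cone hull A \<in> \<Sigma>" if "A \<subseteq> B" for A
    using fan_simplicial_face[OF F _ B(1,2) that] \<sigma> B by simp
  \<comment> \<open>The cell, its new edge at the origin, and its side opposite the origin. Until
    \<open>0 < t'\<close> is known, \<open>w\<close> may be a direction at height 0.\<close>
  have cone3: "convex_cone hull {r1 *\<^sub>R pt 0 0 1, r2 *\<^sub>R pt x y 1, w} \<in> \<Sigma>" (is "?K \<in> _")
    and cone0: "convex_cone hull {r1 *\<^sub>R pt 0 0 1, w} \<in> \<Sigma>" (is "?L \<in> _")
    and coneg: "convex_cone hull {r2 *\<^sub>R pt x y 1, w} \<in> \<Sigma>"
    using r1 r2 w by (intro sub; simp)+
  have K: "convex_cone ?K" "convex_cone ?L" by (rule convex_cone_convex_cone_hull)+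
  have inK: "pt 0 0 1 \<in> ?K" "pt x y 1 \<in> ?K" "w \<in> ?K" "pt 0 0 1 \<in> ?L" "w \<in> ?L"
    using scaleR_mem_convex_cone_iff[OF K(1) r1(1), of "pt 0 0 1"]
      scaleR_mem_convex_cone_iff[OF K(1) r2(1), of "pt x y 1"]
      scaleR_mem_convex_cone_iff[OF K(2) r1(1), of "pt 0 0 1"]
    by (auto simp: hull_inc)
  \<comment> \<open>Otherwise the vertical edge would run through the interior of the cell.\<close>
  have x': "0 \<le> x'"
  proof (rule ccontr)
    assume neg: "\<not> 0 \<le> x'"
    \<comment> \<open>The weights \<open>- x'\<close> on \<open>(x, y)\<close> and \<open>x\<close>
      on \<open>w\<close> cancel the first coordinate and leave \<open>d\<close> as the second.
      Adding \<open>M\<close> times \<open>pt 0 0 1\<close> raises the height enough for the sum to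
      lie in the vertical edge, although its first summand does not.\<close>
    define d M where "d = x * y' - y * x'" and "M = d / b"
    have M: "0 < d" "0 < M" "d = b * M" using det Eb by (auto simp: d_def M_def)
    have "(- x') *\<^sub>R pt x y 1 \<in> ?K"
      using neg by (intro convex_cone_scaleR[OF K(1)] inK) auto
    moreover have "M *\<^sub>R pt 0 0 1 + x *\<^sub>R w \<in> ?K"
      using M x by (intro convex_cone_add[OF K(1)] convex_cone_scaleR[OF K(1)] inK) auto
    moreover have "(- x') *\<^sub>R pt x y 1 + (M *\<^sub>R pt 0 0 1 + x *\<^sub>R w) = pt 0 d (M - x' + x * t')"
      by (simp add: w' d_def algebra_simps)
    moreover have "0 \<le> b * (x * t' - x')"
      using neg x w' Eb by (intro mult_nonneg_nonneg) (auto intro: order_trans[of _ 0] )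
    then have "pt 0 d (M - x' + x * t') \<in> edge 0 0 0 b"
      using Eb M by (auto simp: vertical_edge_mem_iff algebra_simps)
    ultimately have "(- x') *\<^sub>R pt x y 1 \<in> edge 0 0 0 b"
      using fan_add_mem(1)[OF F Eb(1) cone3] by metis
    then show False using Eb x neg by (simp add: vertical_edge_mem_iff)
  qed
  have "0 \<le> y * x'" using y x' by simp
  with det have "0 < x * y'" by linarith
  with x have y': "0 < y'" by (rule zero_less_mult_pos[rotated])
  \<comment> \<open>Otherwise the unbounded edge from the origin would cross the diagonal edge.\<close>
  have t': "0 < t'"
  proof (rule ccontr)
    assume "\<not> 0 < t'"
    then have t0: "t' = 0" using w' by simp
    \<comment> \<open>The factor that moves the origin along \<open>w\<close> onto the diagonal
      segment at height 1.\<close>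
    define k where "k = c / (x' + y')"
    have "k * (x' + y') = c" using x' y' by (simp add: k_def)
    then have k: "0 < k" "k * x' + k * y' = c" using x' y' Ec by (auto simp: k_def distrib_left)
    have "k *\<^sub>R w \<in> ?L" using k by (intro convex_cone_scaleR[OF K(2)] inK) auto
    moreover have "pt 0 0 1 + k *\<^sub>R w \<in> edge c 0 0 c"
      using k x' y' Ec by (simp add: w' t0 diagonal_edge_mem_iff)
    ultimately have "pt 0 0 1 \<in> edge c 0 0 c"
      using fan_add_mem(1)[OF F Ec(1) cone0 inK(4)] by metis
    then show False using Ec by (simp add: diagonal_edge_mem_iff)
  qed
  have w'': "w = t' *\<^sub>R pt (x' / t') (y' / t') 1" using t' by (simp add: w')
  show thesis
  proof
    show "0 \<le> x' / t'" "0 \<le> y' / t'" using x' y' t' by auto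
    show "y * (x' / t') < x * (y' / t')" using det t' by (simp add: divide_strict_right_mono)
    show "edge 0 0 (x' / t') (y' / t') \<in> \<Sigma>" "edge x y (x' / t') (y' / t') \<in> \<Sigma>"
      using cone0 coneg unfolding w'' convex_cone_hull_doubleton_scaleR[OF r1(1) t']
        convex_cone_hull_doubleton_scaleR[OF r2(1) t'] .
  qed
qed

text \<open>Cramer's rule: \<open>(x', y')\<close> solves \<open>m x' + n y' = 0\<close> and
  \<open>k x' + l y' = K\<close>, where \<open>K\<close> is a rational multiple of \<open>a\<close>
  and the determinant \<open>d\<close> is an integer. If \<open>d\<close> were 0, then
  \<open>K\<close> would be 0, making \<open>(k, l)\<close> normal to both \<open>(x, y)\<close> and
  \<open>(x', y')\<close>, against \<open>det\<close>.\<close>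

lemma rational_triangle:
  fixes a x y x' y' :: real and k l m n :: int
  assumes x: "x / a \<in> \<rat>" "y / a \<in> \<rat>" and det: "y * x' < x * y'"
    and mn: "(m, n) \<noteq> (0, 0)" "of_int m * x' + of_int n * y' = 0"
    and kl: "(k, l) \<noteq> (0, 0)" "of_int k * (x' - x) + of_int l * (y' - y) = 0"
  shows "x' / a \<in> \<rat>" "y' / a \<in> \<rat>"
proof -
  define K where "K = of_int k * x + of_int l * y"
  define d :: real where "d = of_int m * of_int l - of_int n * of_int k"
  have K: "K = of_int k * x' + of_int l * y'" using kl by (simp add: K_def algebra_simps)
  have "d * x' = of_int l * (of_int m * x' + of_int n * y') - of_int n * K"
    "d * y' = of_int m * K - of_int k * (of_int m * x' + of_int n * y')"
    by (simp_all add: d_def K algebra_simps)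
  then have d: "d * x' = - of_int n * K" "d * y' = of_int m * K" using mn by auto
  have "d \<noteq> 0"
  proof
    assume "d = 0"
    with d mn have "K = 0" by auto
    have "of_int k * (x * y' - y * x') = y' * (of_int k * x + of_int l * y) - y * (of_int k * x' + of_int l * y')"
      "of_int l * (x * y' - y * x') = x * (of_int k * x' + of_int l * y') - x' * (of_int k * x + of_int l * y)"
      by (simp_all add: algebra_simps)
    then have "of_int k * (x * y' - y * x') = 0" "of_int l * (x * y' - y * x') = 0"
      using \<open>K = 0\<close> K by (simp_all add: K_def)
    with det kl show False by auto
  qed
  then have "x' / a = d * x' / a / d" "y' / a = d * y' / a / d"
    by simp_all
  then have "x' / a = - of_int n * (K / a) / d" "y' / a = of_int m * (K / a) / d"
    unfolding d by simp_all
  moreover have "K / a = of_int k * (x / a) + of_int l * (y / a)"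
    by (simp add: K_def add_divide_distrib)
  then have "K / a \<in> \<rat>" using x by (simp only: Rats_add Rats_mult Rats_of_int)
  moreover have "d \<in> \<rat>" by (simp add: d_def)
  ultimately show "x' / a \<in> \<rat>" "y' / a \<in> \<rat>"
    by (simp_all only: Rats_mult Rats_divide Rats_minus_iff Rats_of_int)
qed

text \<open>The end of the shorter segment is an inner point of the longer one. Splitting it along
  the endpoints of the longer segment would force \<open>(0, b)\<close> into the shorter
  one.\<close>

lemma fan_vertical_edge_unique:
  assumes F: "fan W \<Sigma>" and "edge 0 0 0 y \<in> \<Sigma>" "edge 0 0 0 b \<in> \<Sigma>" "0 < y" "y < b"
  shows False
proof -
  have "pt 0 0 (1 - y / b) \<in> edge 0 0 0 b" "pt 0 y (y / b) \<in> edge 0 0 0 b"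
    "pt 0 0 (1 - y / b) + pt 0 y (y / b) \<in> edge 0 0 0 y"
    using assms by (auto simp: vertical_edge_mem_iff)
  from fan_add_mem(2)[OF F assms(2,3) this] show False
    using assms by (auto simp: vertical_edge_mem_iff field_simps)
qed

text \<open>Each endpoint is the other one times a factor at most 1. Used in both directions, this
  shows that the cone determines the endpoint, so a finite fan has finitely many of them.\<close>

lemma edge_eq_imp:
  assumes "edge 0 0 x y = edge 0 0 x' y'" "0 \<le> x" "0 \<le> y" "0 \<le> x'" "0 \<le> y'"
  shows "x \<le> x'" "y \<le> y'"
proof -
  have "pt x y 1 \<in> edge 0 0 x y" by (simp add: hull_inc)
  then have "pt x y 1 \<in> edge 0 0 x' y'" unfolding assms(1) .
  then obtain r s where "0 \<le> r" "0 \<le> s" "r + s = 1" "x = s * x'" "y = s * y'"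
    by (auto simp: edge_mem_iff)
  then show "x \<le> x'" "y \<le> y'" using assms mult_right_mono[of s 1] by auto
qed

text \<open>The turning is organised as a maximality argument: among the finitely many edges at the
  origin with endpoint in the quadrant and in rational multiples of \<open>a\<close>, the steepest
  must be vertical, since otherwise the next vertex would be steeper and again of this kind.\<close>

lemma completion_imp_commensurable:
  assumes fan: "half_space_fan lat \<Sigma>" and complete: "complete_fan lat \<Sigma>"
    and simpl: "simplicial_fan \<Sigma>" and adm: "admissible_fan \<Gamma> lat \<Sigma>"
    and Ea: "edge 0 0 a 0 \<in> \<Sigma>" "0 < a" and Eb: "edge 0 0 0 b \<in> \<Sigma>" "0 < b"
    and Ec: "edge c 0 0 c \<in> \<Sigma>" "0 < c"
  shows "b / a \<in> \<rat>"
proof -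
  have F: "fan (span lat \<times> UNIV) \<Sigma>"
    using fan by (auto simp: half_space_fan_def)
  define G where "G = {(x, y). 0 \<le> x \<and> 0 \<le> y \<and> 0 < x + y \<and> edge 0 0 x y \<in> \<Sigma> \<and> x / a \<in> \<rat> \<and> y / a \<in> \<rat>}"
  \<comment> \<open>Increases with the angle in the quadrant and, unlike \<open>y / x\<close>, also
    measures the vertical direction. The condition \<open>0 < x + y\<close> in \<open>G\<close>
    excludes the degenerate edge.\<close>
  define slope where "slope = (\<lambda>(x, y). y / (x + y) :: real)"
  have "inj_on (\<lambda>(x, y). edge 0 0 x y) G"
  proof (rule inj_onI, clarify)
    fix x y x' y' assume "(x, y) \<in> G" "(x', y') \<in> G" and eq: "edge 0 0 x y = edge 0 0 x' y'"
    then have "0 \<le> x" "0 \<le> y" "0 \<le> x'" "0 \<le> y'" by (auto simp: G_def)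
    then show "x = x' \<and> y = y'"
      using edge_eq_imp[OF eq] edge_eq_imp[OF eq[symmetric]] by simp
  qed
  moreover have "(\<lambda>(x, y). edge 0 0 x y) ` G \<subseteq> \<Sigma>"
    by (auto simp: G_def)
  moreover have "finite \<Sigma>"
    using F by (auto simp: fan_def polyhedral_complex_def)
  ultimately have "finite G"
    using inj_on_finite by blast
  moreover have "(a, 0) \<in> G"
    using Ea by (simp add: G_def)
  ultimately have "Max (slope ` G) \<in> slope ` G" and max: "\<And>g. g \<in> G \<Longrightarrow> slope g \<le> Max (slope ` G)"
    by (auto intro!: Max_in)
  then obtain x y where xy: "(x, y) \<in> G" "Max (slope ` G) = slope (x, y)" by auto
  have "x = 0"
  proof (rule ccontr)
    assume "x \<noteq> 0"
    then have x: "0 < x" "0 \<le> y" and Eg: "edge 0 0 x y \<in> \<Sigma>" and rat: "x / a \<in> \<rat>" "y / a \<in> \<rat>"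
      using xy by (auto simp: G_def)
    obtain x' y' where g: "0 \<le> x'" "0 \<le> y'" "y * x' < x * y'"
      "edge 0 0 x' y' \<in> \<Sigma>" "edge x y x' y' \<in> \<Sigma>"
      using completion_next_vertex[OF fan complete simpl adm Eb Ec Eg x] .
    have "0 \<le> y * x'" using x g by simp
    with g have "0 < x * y'" by linarith
    with x have y': "0 < y'" by (simp add: zero_less_mult_iff)
    have adm': "admissible_cone \<Gamma> lat (edge 0 0 x' y')" "admissible_cone \<Gamma> lat (edge x y x' y')"
      using adm g(4,5) by (auto simp: admissible_fan_def)
    have ne: "(0, 0) \<noteq> (x', y')" "(x, y) \<noteq> (x', y')" using g(3) y' by auto
    obtain m n :: int where mn: "(m, n) \<noteq> (0, 0)" "of_int m * (x' - 0) + of_int n * (y' - 0) = 0"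
      by (rule admissible_edge_rational_slope[OF adm'(1) ne(1)])
    obtain k l :: int where kl: "(k, l) \<noteq> (0, 0)" "of_int k * (x' - x) + of_int l * (y' - y) = 0"
      by (rule admissible_edge_rational_slope[OF adm'(2) ne(2)])
    have "(x', y') \<in> G"
      using rational_triangle[OF rat g(3) mn(1) _ kl] mn(2) g y' by (simp add: G_def)
    then have "y' / (x' + y') \<le> y / (x + y)"
      using max xy by (fastforce simp: slope_def)
    then have "y' * (x + y) \<le> y * (x' + y')"
      using x g y' by (simp add: field_simps)
    with g show False by (simp add: algebra_simps)
  qed
  with xy have y: "0 < y" "edge 0 0 0 y \<in> \<Sigma>" "y / a \<in> \<rat>" by (auto simp: G_def)
  then have "y = b"
    using fan_vertical_edge_unique[OF F y(2) Eb(1)] fan_vertical_edge_unique[OF F Eb(1) y(2)] Eb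
    by (meson linorder_neqE)
  with y show ?thesis by simp
qed

subsection \<open>The fan of three segments\<close>

lemma half_space_eqI:
  assumes "S \<subseteq> half_space lat" "T \<subseteq> half_space lat" "\<And>x y t. pt x y t \<in> S \<longleftrightarrow> pt x y t \<in> T"
  shows "S = T"
  using assms by (intro set_eqI) (metis half_spaceE subsetD)

text \<open>All generators lie in the octant \<open>Q\<close>, a convex cone without lines inside
  the half-space; both properties pass to the hull.\<close>

lemma quadrant_hull:
  assumes "B \<subseteq> {pt x y 1 | x y. 0 \<le> x \<and> 0 \<le> y}"
  shows "convex_cone hull B \<subseteq> half_space lat" "strongly_convex_cone (convex_cone hull B)"
proof -
  define Q where "Q = {pt x y t | x y t. 0 \<le> x \<and> 0 \<le> y \<and> 0 \<le> t}"
  have pt_Q: "pt x y t \<in> Q \<longleftrightarrow> 0 \<le> x \<and> 0 \<le> y \<and> 0 \<le> t" for x y t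
    by (auto simp: Q_def)
  have "convex_cone Q"
    unfolding convex_cone_iff
  proof (intro conjI ballI allI impI)
    show "0 \<in> Q" using pt_Q[of 0 0 0] by (metis pt_eq_0_iff order_refl)
  qed (auto simp: Q_def)
  moreover have "{pt x y 1 | x y. 0 \<le> x \<and> 0 \<le> y} \<subseteq> Q"
    unfolding Q_def using zero_le_one by blast
  with assms have "B \<subseteq> Q" by (rule order_trans)
  ultimately have hull: "convex_cone hull B \<subseteq> Q" by (intro hull_minimal)
  then show "convex_cone hull B \<subseteq> half_space lat"
    by (force simp: Q_def)
  \<comment> \<open>For \<open>\<beta> \<noteq> 0\<close> the chosen parameter gives the value
    -1.\<close>
  have zero: "\<beta> = 0" if "\<And>r. 0 \<le> \<alpha> + r * \<beta>" for \<alpha> \<beta> :: real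
    using that[of "- (\<alpha> + 1) / \<beta>"] by (cases "\<beta> = 0") auto
  have "v = 0" if line: "\<And>r. p + r *\<^sub>R v \<in> Q" for p v
  proof -
    obtain x y t where p: "p = pt x y t" using line[of 0] by (auto simp: Q_def)
    obtain x' y' t' where "p + v = pt x' y' t'" using line[of 1] by (auto simp: Q_def)
    then have "v = pt x' y' t' + (-1) *\<^sub>R p" by (metis add_diff_cancel_left' scaleR_minus1_left uminus_add_conv_diff add.commute)
    then have v: "v = pt (x' - x) (y' - y) (t' - t)" by (simp add: p)
    have "0 \<le> x + r * (x' - x) \<and> 0 \<le> y + r * (y' - y) \<and> 0 \<le> t + r * (t' - t)" for r
      using line[of r] unfolding p v by (simp add: pt_Q)
    then show ?thesis unfolding v using zero by (metis pt_eq_0_iff)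
  qed
  with hull have "\<not> contains_line (convex_cone hull B)"
    unfolding contains_line_def by (metis subsetD)
  then show "strongly_convex_cone (convex_cone hull B)"
    by (simp add: strongly_convex_cone_def convex_cone_convex_cone_hull)
qed

text \<open>Reduces admissibility to a list of explicit inequalities, a triple
  \<open>(m, n, \<gamma>)\<close> standing for the functional \<open>m X + n Y\<close> with constant
  \<open>\<gamma>\<close>.\<close>

lemma admissible_coneI:
  fixes hs :: "(int \<times> int \<times> real) list"
  assumes "strongly_convex_cone \<sigma>" "\<sigma> \<subseteq> half_space lat" and \<Gamma>: "\<forall>(m, n, \<gamma>)\<in>set hs. \<gamma> \<in> \<Gamma>"
    and mem: "\<And>x y t. pt x y t \<in> \<sigma> \<longleftrightarrow>
      0 \<le> t \<and> (\<forall>(m, n, \<gamma>)\<in>set hs. 0 \<le> of_int m * x + of_int n * y + \<gamma> * t)"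
  shows "admissible_cone \<Gamma> lat \<sigma>"
proof -
  \<comment> \<open>Inequalities are numbered from 1 but list positions from 0, hence
    \<open>i - 1\<close>.\<close>
  define u where "u i v = of_int (fst (hs ! (i - 1))) * X v + of_int (fst (snd (hs ! (i - 1)))) * Y v"
    for i and v :: 'v
  define \<gamma> where "\<gamma> i = snd (snd (hs ! (i - 1)))" for i
  have nth: "(\<forall>i\<in>{1..length hs}. P (hs ! (i - 1))) \<longleftrightarrow> (\<forall>h\<in>set hs. P h)" for P
  proof
    assume *: "\<forall>i\<in>{1..length hs}. P (hs ! (i - 1))"
    show "\<forall>h\<in>set hs. P h"
    proof
      fix h assume "h \<in> set hs"
      then obtain i where "i < length hs" "h = hs ! i" by (auto simp: in_set_conv_nth)
      then show "P h" using bspec[OF *, of "Suc i"] by simp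
    qed
  qed auto
  have "u i \<in> dual_lattice lat" for i
  proof -
    have "linear (u i)"
      unfolding u_def by (rule linearI) (auto simp: algebra_simps)
    then show ?thesis by (auto simp: dual_lattice_def lat_def u_def)
  qed
  moreover have "\<forall>i\<in>{1..length hs}. \<gamma> i \<in> \<Gamma>"
    unfolding \<gamma>_def nth[of "\<lambda>h. snd (snd h) \<in> \<Gamma>"] using \<Gamma> by auto
  moreover have "\<sigma> = {(w, t) \<in> half_space lat. \<forall>i\<in>{1..length hs}. u i w + \<gamma> i * t \<ge> 0}"
  proof (rule half_space_eqI)
    fix x y t
    have "(\<forall>i\<in>{1..length hs}. u i (x *\<^sub>R e1 + y *\<^sub>R e2) + \<gamma> i * t \<ge> 0) \<longleftrightarrow>
        (\<forall>h\<in>set hs. 0 \<le> of_int (fst h) * x + of_int (fst (snd h)) * y + snd (snd h) * t)"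
      using nth[of "\<lambda>h. 0 \<le> of_int (fst h) * x + of_int (fst (snd h)) * y + snd (snd h) * t"]
      by (simp add: u_def \<gamma>_def)
    moreover have "pt x y t \<in> {(w, t) \<in> half_space lat. \<forall>i\<in>{1..length hs}. u i w + \<gamma> i * t \<ge> 0} \<longleftrightarrow>
      pt x y t \<in> half_space lat \<and> (\<forall>i\<in>{1..length hs}. u i (x *\<^sub>R e1 + y *\<^sub>R e2) + \<gamma> i * t \<ge> 0)"
      unfolding pt_def by simp
    ultimately show "pt x y t \<in> \<sigma> \<longleftrightarrow>
        pt x y t \<in> {(w, t) \<in> half_space lat. \<forall>i\<in>{1..length hs}. u i w + \<gamma> i * t \<ge> 0}"
      by (simp add: mem split_beta)
  qed (use assms(2) in auto)
  ultimately show ?thesis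
    unfolding admissible_cone_def
    by (intro conjI exI[of _ "length hs"] exI[of _ u] exI[of _ \<gamma>] assms(1)) simp_all
qed

text \<open>The inequality \<open>t \<le> 0\<close> must have its coefficient in \<open>\<Gamma>\<close>, so it is written \<open>- a t \<ge> 0\<close>.\<close>
lemma admissible_zero_cone:
  assumes "0 \<in> \<Gamma>" "- a \<in> \<Gamma>" "0 < a"
  shows "admissible_cone \<Gamma> lat (convex_cone hull {})"
proof (rule admissible_coneI)
  fix x y t
  show "pt x y t \<in> convex_cone hull {} \<longleftrightarrow> 0 \<le> t \<and> (\<forall>(m, n, \<gamma>)\<in>set
      [(1, 0, 0), (- 1, 0, 0), (0, 1, 0), (0, - 1, 0), (0, 0, - a)]. 0 \<le> of_int m * x + of_int n * y + \<gamma> * t)"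
    using assms by (auto simp: convex_cone_hull_finite mult_le_0_iff)
qed (use assms quadrant_hull[of "{}"] in simp_all)

text \<open>The two equations of the ray are written as pairs of opposite inequalities, which is why
  both signs of each coordinate must lie in \<open>\<Gamma>\<close>.\<close>

lemma admissible_ray:
  assumes "0 \<le> x" "0 \<le> y" "0 \<in> \<Gamma>" "x \<in> \<Gamma>" "- x \<in> \<Gamma>" "y \<in> \<Gamma>" "- y \<in> \<Gamma>"
  shows "admissible_cone \<Gamma> lat (convex_cone hull {pt x y 1})"
proof (rule admissible_coneI)
  fix x' y' t
  show "pt x' y' t \<in> convex_cone hull {pt x y 1} \<longleftrightarrow> 0 \<le> t \<and> (\<forall>(m, n, \<gamma>)\<in>set
      [(1, 0, - x), (- 1, 0, x), (0, 1, - y), (0, - 1, y)]. 0 \<le> of_int m * x' + of_int n * y' + \<gamma> * t)"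
    by (auto simp: convex_cone_hull_singleton mult.commute)
qed (use assms quadrant_hull[of "{pt x y 1}"] in simp_all)

lemma admissible_horizontal_edge:
  assumes "0 < a" "0 \<in> \<Gamma>" "a \<in> \<Gamma>"
  shows "admissible_cone \<Gamma> lat (edge 0 0 a 0)"
proof (rule admissible_coneI)
  fix x y t
  show "pt x y t \<in> edge 0 0 a 0 \<longleftrightarrow> 0 \<le> t \<and> (\<forall>(m, n, \<gamma>)\<in>set
      [(0, 1, 0), (0, - 1, 0), (1, 0, 0), (- 1, 0, a)]. 0 \<le> of_int m * x + of_int n * y + \<gamma> * t)"
    using assms nonneg_of_le_mult[of x a t] by (auto simp: horizontal_edge_mem_iff)
qed (use assms quadrant_hull[of "{pt 0 0 1, pt a 0 1}"] in simp_all)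

lemma admissible_vertical_edge:
  assumes "0 < b" "0 \<in> \<Gamma>" "b \<in> \<Gamma>"
  shows "admissible_cone \<Gamma> lat (edge 0 0 0 b)"
proof (rule admissible_coneI)
  fix x y t
  show "pt x y t \<in> edge 0 0 0 b \<longleftrightarrow> 0 \<le> t \<and> (\<forall>(m, n, \<gamma>)\<in>set
      [(1, 0, 0), (- 1, 0, 0), (0, 1, 0), (0, - 1, b)]. 0 \<le> of_int m * x + of_int n * y + \<gamma> * t)"
    using assms nonneg_of_le_mult[of y b t] by (auto simp: vertical_edge_mem_iff)
qed (use assms quadrant_hull[of "{pt 0 0 1, pt 0 b 1}"] in simp_all)

lemma admissible_diagonal_edge:
  assumes "0 < c" "0 \<in> \<Gamma>" "c \<in> \<Gamma>" "- c \<in> \<Gamma>"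
  shows "admissible_cone \<Gamma> lat (edge c 0 0 c)"
proof (rule admissible_coneI)
  fix x y t
  show "pt x y t \<in> edge c 0 0 c \<longleftrightarrow> 0 \<le> t \<and> (\<forall>(m, n, \<gamma>)\<in>set
      [(1, 0, 0), (0, 1, 0), (1, 1, - c), (- 1, - 1, c)]. 0 \<le> of_int m * x + of_int n * y + \<gamma> * t)"
    using assms nonneg_of_le_mult[of "x + y" c t] by (auto simp: diagonal_edge_mem_iff)
qed (use assms quadrant_hull[of "{pt c 0 1, pt 0 c 1}"] in simp_all)

text \<open>The fan consists of all nonempty faces of the three cones. The two axis edges share the
  ray over the origin, and \<open>a < c\<close>, \<open>b < c\<close> keep both away from the
  diagonal. Every face is the hull of a subset of a generating pair, so admissibility is a finite
  check.\<close>

lemma three_edges_fan: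
  assumes zero: "0 \<in> \<Gamma>" and diff: "\<And>x y. x \<in> \<Gamma> \<Longrightarrow> y \<in> \<Gamma> \<Longrightarrow> x - y \<in> \<Gamma>"
    and \<Gamma>: "a \<in> \<Gamma>" "b \<in> \<Gamma>" "c \<in> \<Gamma>" and pos: "0 < a" "0 < b" "a < c" "b < c"
  obtains \<Sigma> where "half_space_fan lat \<Sigma>" "simplicial_fan \<Sigma>" "admissible_fan \<Gamma> lat \<Sigma>"
    "edge 0 0 a 0 \<in> \<Sigma>" "edge 0 0 0 b \<in> \<Sigma>" "edge c 0 0 c \<in> \<Sigma>"
proof -
  define Bs where "Bs = {{pt 0 0 1, pt a 0 1}, {pt 0 0 1, pt 0 b 1}, {pt c 0 1, pt 0 c 1}}"
  define M where "M = (hull) convex_cone ` Bs"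
  define \<Sigma> where "\<Sigma> = {F. F \<noteq> {} \<and> (\<exists>\<sigma>\<in>M. F face_of \<sigma>)}"
  have Bs: "finite B" "independent B" "B \<subseteq> {pt x y 1 | x y. 0 \<le> x \<and> 0 \<le> y}"
    if "B \<in> Bs" for B
    using that pos independent_pt[of 0 0 a 0] independent_pt[of 0 0 0 b] independent_pt[of c 0 0 c]
    unfolding Bs_def by (elim insertE emptyE; simp)+
  have face: "\<exists>B\<in>Bs. \<exists>C\<subseteq>B. F = convex_cone hull C" if "F \<in> \<Sigma>" for F
    using that Bs(1) face_of_convex_cone_hull_finite unfolding \<Sigma>_def M_def by blast
  have neg: "- x \<in> \<Gamma>" if "x \<in> \<Gamma>" for x
    using diff[OF zero that] by simp
  have adm: "admissible_cone \<Gamma> lat F" if "F \<in> \<Sigma>" for F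
  proof -
    obtain B C where BC: "B \<in> Bs" "C \<subseteq> B" "F = convex_cone hull C"
      using face \<open>F \<in> \<Sigma>\<close> by blast
    have "admissible_cone \<Gamma> lat (convex_cone hull {})"
      using admissible_zero_cone[OF zero neg[OF \<Gamma>(1)] pos(1)] .
    moreover have "admissible_cone \<Gamma> lat (convex_cone hull {pt x y 1})"
      if "x \<in> {0, a, c}" "y \<in> {0, b, c}" for x y
    proof (rule admissible_ray)
      show "x \<in> \<Gamma>" "y \<in> \<Gamma>" using that zero \<Gamma> by auto
      then show "- x \<in> \<Gamma>" "- y \<in> \<Gamma>" by (auto intro: neg)
    qed (use that zero pos in auto)
    then have "admissible_cone \<Gamma> lat (convex_cone hull {pt 0 0 1})"
      "admissible_cone \<Gamma> lat (convex_cone hull {pt a 0 1})"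
      "admissible_cone \<Gamma> lat (convex_cone hull {pt 0 b 1})"
      "admissible_cone \<Gamma> lat (convex_cone hull {pt c 0 1})"
      "admissible_cone \<Gamma> lat (convex_cone hull {pt 0 c 1})"
      by simp_all
    moreover have "admissible_cone \<Gamma> lat (edge 0 0 a 0)" "admissible_cone \<Gamma> lat (edge 0 0 0 b)"
      using zero \<Gamma> pos by (simp_all add: admissible_horizontal_edge admissible_vertical_edge)
    moreover have "admissible_cone \<Gamma> lat (edge c 0 0 c)"
      using zero \<Gamma> pos neg[OF \<Gamma>(3)] by (simp add: admissible_diagonal_edge)
    moreover have "C = {} \<or> C = {u} \<or> C = {v} \<or> C = {u, v}" if "C \<subseteq> {u, v}" for u v
      using that by blast
    ultimately show ?thesis
      using BC unfolding Bs_def by (elim insertE emptyE) metis+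
  qed
  have hull_half: "convex_cone hull C \<subseteq> half_space lat" if "B \<in> Bs" "C \<subseteq> B" for B C
    using that Bs(3) by (intro quadrant_hull(1)) blast
  have inter: "\<sigma> \<inter> \<tau> face_of \<sigma>" if "\<sigma> \<in> M" "\<tau> \<in> M" for \<sigma> \<tau>
  proof -
    \<comment> \<open>Two of these cones meet in the hull of their common generators, which is a
      face by \<open>simplicial_cone_face_of\<close>.\<close>
    have hull_Int: "convex_cone hull B \<inter> convex_cone hull B' = convex_cone hull (B \<inter> B')"
      if "B \<in> Bs" "B' \<in> Bs" for B B'
    proof (rule half_space_eqI)
      show "convex_cone hull B \<inter> convex_cone hull B' \<subseteq> half_space lat"
        "convex_cone hull (B \<inter> B') \<subseteq> half_space lat"
        using hull_half[OF that(1)] by blast+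
      have ray: "pt x y t \<in> convex_cone hull {pt 0 0 1} \<longleftrightarrow> x = 0 \<and> y = 0 \<and> 0 \<le> t" for x y t
        by (auto simp: convex_cone_hull_singleton)
      have z: "pt x y t \<in> convex_cone hull {} \<longleftrightarrow> x = 0 \<and> y = 0 \<and> t = 0" for x y t
        by (auto simp: convex_cone_hull_finite)
      \<comment> \<open>A point of the diagonal cone on an axis has coordinate \<open>c * t\<close>,
        while the axis edge bounds it by \<open>d * t\<close> with \<open>d\<close> being
        \<open>a\<close> or \<open>b\<close>. Only the apex remains.\<close>
      have zero: "x = 0 \<and> t = 0" if "0 \<le> x" "x \<le> d * t" "x = c * t" "0 < d" "d < c" for x t d :: real
      proof -
        have "0 \<le> t" using nonneg_of_le_mult that by blast
        moreover have "(c - d) * t \<le> 0" using that by (simp add: algebra_simps)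
        with \<open>d < c\<close> have "t \<le> 0" by (simp add: mult_le_0_iff)
        ultimately show ?thesis using that by simp
      qed
      fix x y t
      have "{pt 0 0 1, pt a 0 1} \<inter> {pt 0 0 1, pt 0 b 1} = {pt 0 0 1}"
        "{pt 0 0 1, pt a 0 1} \<inter> {pt c 0 1, pt 0 c 1} = {}"
        "{pt 0 0 1, pt 0 b 1} \<inter> {pt c 0 1, pt 0 c 1} = {}"
        using pos by auto
      moreover have "pt x y t \<in> edge 0 0 a 0 \<and> pt x y t \<in> edge 0 0 0 b \<longleftrightarrow> pt x y t \<in> convex_cone hull {pt 0 0 1}"
        using pos nonneg_of_le_mult[of 0 a t] by (auto simp: horizontal_edge_mem_iff vertical_edge_mem_iff ray)
      moreover have "pt x y t \<in> edge 0 0 a 0 \<and> pt x y t \<in> edge c 0 0 c \<longleftrightarrow> pt x y t \<in> convex_cone hull {}"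
        using pos zero[of x a t] by (auto simp: horizontal_edge_mem_iff diagonal_edge_mem_iff z)
      moreover have "pt x y t \<in> edge 0 0 0 b \<and> pt x y t \<in> edge c 0 0 c \<longleftrightarrow> pt x y t \<in> convex_cone hull {}"
        using pos zero[of y b t] by (auto simp: vertical_edge_mem_iff diagonal_edge_mem_iff z)
      ultimately show "pt x y t \<in> convex_cone hull B \<inter> convex_cone hull B' \<longleftrightarrow>
          pt x y t \<in> convex_cone hull (B \<inter> B')"
        using that unfolding Bs_def by (elim insertE emptyE) (simp_all only: Int_iff Int_absorb Int_commute conj_commute simp_thms)
    qed
    obtain B B' where B: "B \<in> Bs" "B' \<in> Bs" "\<sigma> = convex_cone hull B" "\<tau> = convex_cone hull B'"
      using \<open>\<sigma> \<in> M\<close> \<open>\<tau> \<in> M\<close> unfolding M_def by blast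
    show ?thesis
      unfolding B(3,4) hull_Int[OF B(1,2)]
      by (rule simplicial_cone_face_of[OF Bs(1)[OF B(1)] Bs(2)[OF B(1)] Int_lower1])
  qed
  have "polyhedral_complex (span lat \<times> UNIV) \<Sigma>"
    unfolding \<Sigma>_def
  proof (rule polyhedral_complex_faces)
    show "finite M" by (simp add: M_def Bs_def)
    show "polyhedron_in (span lat \<times> UNIV) F" if "\<sigma> \<in> M" "F face_of \<sigma>" "F \<noteq> {}" for \<sigma> F
      using that adm admissible_cone_imp_polyhedron_in unfolding \<Sigma>_def by blast
    show "finite {F. F face_of \<sigma>}" if "\<sigma> \<in> M" for \<sigma>
    proof -
      obtain B where B: "B \<in> Bs" "\<sigma> = convex_cone hull B" using \<open>\<sigma> \<in> M\<close> by (auto simp: M_def)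
      \<comment> \<open>The empty set also counts under \<open>face_of\<close>, so it joins the
        hulls of subsets of \<open>B\<close>.\<close>
      have "{F. F face_of \<sigma>} \<subseteq> insert {} ((hull) convex_cone ` Pow B)"
        using face_of_convex_cone_hull_finite Bs(1) B by blast
      then show ?thesis using Bs(1)[OF B(1)] finite_subset by blast
    qed
  qed (rule inter)
  moreover have M_sub: "M \<subseteq> \<Sigma>"
  proof
    fix \<sigma> assume "\<sigma> \<in> M"
    then have "\<sigma> face_of \<sigma>" "\<sigma> \<noteq> {}"
      by (auto simp: M_def convex_cone_hull_nonempty face_of_refl convex_convex_cone_hull)
    with \<open>\<sigma> \<in> M\<close> show "\<sigma> \<in> \<Sigma>" by (auto simp: \<Sigma>_def)
  qed
  then have "\<Sigma> \<noteq> {}" by (auto simp: M_def Bs_def)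
  moreover have "strongly_convex_cone F" if "F \<in> \<Sigma>" for F
    using adm[OF that] by (simp add: admissible_cone_def)
  moreover have "F \<subseteq> half_space lat" if "F \<in> \<Sigma>" for F
    using face[OF that] hull_half by auto
  ultimately have "half_space_fan lat \<Sigma>"
    by (simp add: half_space_fan_def fan_def)
  moreover have "simplicial_fan \<Sigma>"
    unfolding simplicial_fan_def
  proof
    fix F assume "F \<in> \<Sigma>"
    then obtain B C where "B \<in> Bs" "C \<subseteq> B" "F = convex_cone hull C" using face by blast
    then show "\<exists>B. finite B \<and> independent B \<and> F = convex_cone hull B"
      using Bs(1,2) finite_subset independent_mono by metis
  qed
  moreover have "admissible_fan \<Gamma> lat \<Sigma>" using adm by (simp add: admissible_fan_def)
  moreover have "edge 0 0 a 0 \<in> \<Sigma>" "edge 0 0 0 b \<in> \<Sigma>" "edge c 0 0 c \<in> \<Sigma>"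
    using M_sub by (auto simp: M_def Bs_def)
  ultimately show thesis
    by (rule that)
qed

end

section \<open>Realisation in finitely supported sequences\<close>

lemma lookup_scaleR_real:
  "Poly_Mapping.lookup (r *\<^sub>R v) i = r * Poly_Mapping.lookup v i" for v :: "'a \<Rightarrow>\<^sub>0 real"
proof -
  have "finite {i. r *\<^sub>R Poly_Mapping.lookup v i \<noteq> 0}"
    by (rule finite_subset[OF _ finite_lookup[of v]]) auto
  then show ?thesis
    by (simp add: scaleR_poly_mapping_def lookup_Abs_poly_mapping)
qed

theorem theorem1p4:
  fixes \<Gamma> :: "real set"
  assumes "0 \<in> \<Gamma>" and "\<And>x y. x \<in> \<Gamma> \<Longrightarrow> y \<in> \<Gamma> \<Longrightarrow> x - y \<in> \<Gamma>"
    and "\<exists>a\<in>\<Gamma>. \<exists>b\<in>\<Gamma>. \<forall>p q :: rat. of_rat p * a + of_rat q * b = 0 \<longrightarrow> p = 0 \<and> q = 0"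
  shows "\<exists>N :: (nat \<Rightarrow>\<^sub>0 real) set. is_lattice N \<and>
    (\<exists>\<Sigma>. half_space_fan N \<Sigma> \<and> simplicial_fan \<Sigma> \<and> admissible_fan \<Gamma> N \<Sigma> \<and>
      \<not> (\<exists>\<Sigma>'. half_space_fan N \<Sigma>' \<and> complete_fan N \<Sigma>' \<and> simplicial_fan \<Sigma>' \<and>
             admissible_fan \<Gamma> N \<Sigma>' \<and> \<Sigma> \<subseteq> \<Sigma>'))"
proof -
  define e1 e2 :: "nat \<Rightarrow>\<^sub>0 real" where "e1 = Poly_Mapping.single 1 1" and "e2 = Poly_Mapping.single 2 1"
  interpret lattice_plane e1 e2 "\<lambda>v. Poly_Mapping.lookup v 1" "\<lambda>v. Poly_Mapping.lookup v 2"
    by unfold_locales (auto simp: e1_def e2_def lookup_single lookup_add lookup_scaleR_real when_def intro!: linearI)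
  obtain a0 b0 where ab0: "a0 \<in> \<Gamma>" "b0 \<in> \<Gamma>"
    "\<And>p q :: rat. of_rat p * a0 + of_rat q * b0 = 0 \<Longrightarrow> p = 0 \<and> q = 0"
    using assms(3) by blast
  \<comment> \<open>Absolute values stay in \<open>\<Gamma>\<close>, which is closed under negation,
    and do not affect the irrationality of the ratio. Positivity makes \<open>a + b\<close> exceed
    both.\<close>
  define a b where "a = \<bar>a0\<bar>" and "b = \<bar>b0\<bar>"
  have neg: "- x \<in> \<Gamma>" if "x \<in> \<Gamma>" for x
    using assms(2)[OF assms(1) that] by simp
  have ab: "a \<in> \<Gamma>" "b \<in> \<Gamma>" using ab0 neg by (auto simp: a_def b_def abs_if)
  have "a + b \<in> \<Gamma>" using assms(2)[OF ab(1) neg[OF ab(2)]] by simp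
  have "a0 \<noteq> 0" "b0 \<noteq> 0" using ab0(3)[of 1 0] ab0(3)[of 0 1] by auto
  then have pos: "0 < a" "0 < b" by (auto simp: a_def b_def)
  have irr: "b / a \<notin> \<rat>"
  proof
    assume "b / a \<in> \<rat>"
    then have "b0 / a0 \<in> \<rat>" by (auto simp: a_def b_def abs_if split: if_splits)
    then obtain q where "b0 / a0 = of_rat q" by (auto elim: Rats_cases)
    \<comment> \<open>A rational ratio gives a relation with coefficient -1 at \<open>b0\<close>,
      hence a nontrivial one.\<close>
    then have "of_rat q * a0 + of_rat (- 1) * b0 = 0" using \<open>a0 \<noteq> 0\<close> by (simp add: field_simps)
    then show False using ab0(3) by fastforce
  qed
  obtain \<Sigma> where \<Sigma>: "half_space_fan lat \<Sigma>" "simplicial_fan \<Sigma>" "admissible_fan \<Gamma> lat \<Sigma>"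
    "edge 0 0 a 0 \<in> \<Sigma>" "edge 0 0 0 b \<in> \<Sigma>" "edge (a + b) 0 0 (a + b) \<in> \<Sigma>"
    by (rule three_edges_fan[OF assms(1,2) ab \<open>a + b \<in> \<Gamma>\<close>]) (use pos in auto)
  have "\<not> (half_space_fan lat \<Sigma>' \<and> complete_fan lat \<Sigma>' \<and> simplicial_fan \<Sigma>' \<and>
      admissible_fan \<Gamma> lat \<Sigma>' \<and> \<Sigma> \<subseteq> \<Sigma>')" for \<Sigma>'
    using completion_imp_commensurable[of \<Sigma>' \<Gamma> a b "a + b"] \<Sigma>(4-6) pos irr by auto
  then show ?thesis
    by (intro exI[of _ lat] conjI exI[of _ \<Sigma>] is_lattice_lat \<Sigma>(1-3)) blast
qed

end
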